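(* Assume that the block Jacobi operator $J$ is self-adjoint and let $G\subset\mathbb{R}$ be non-empty. If $\mathfrak{b}$ is a barrier for $J$ on $G$, then for any $\lambda\in G$ and any $\epsilon>0$ with $\ell_\lambda(\epsilon)\ge1$, $$\big(8\,\mathfrak{b}(\lambda,\ell_\lambda(\epsilon))\big)^{-1}\operatorname{I}\le\operatorname{Im}W(\lambda+i\epsilon)$$ and $$s_-(\lambda,\epsilon)\le\|W(\lambda+i\epsilon)\|\le s_+(\lambda,\epsilon),$$ where $$s_\pm(\lambda,\epsilon):=4d\,\mathfrak{b}(\lambda,\ell_\lambda(\epsilon))\pm\sqrt{\big(4d\,\mathfrak{b}(\lambda,\ell_\lambda(\epsilon))\big)^2-1}.$$
   Context: Setting. Fix $d\in\mathbb{N}$, $d\ge 1$, and sequences $(A_n)_{n\ge 0}$, $(B_n)_{n\ge 0}$ of complex $d\times d$ matrices with $\det A_n\neq 0$ and $B_n=B_n^*$ for all $n\ge 0$. Put $A_{-1}:=-\operatorname{I}$. For a sequence $u=(u_n)_{n\ge0}$ in $\mathbb{C}^d$ set $(\mathcal{J}u)_0=B_0u_0+A_0u_1$ and $(\mathcal{J}u)_n=A_{n-1}^*u_{n-1}+B_nu_n+A_nu_{n+1}$ for $n\ge1$. The (maximal) block Jacobi operator $J$ in $\ell^2(\mathbb{N}_0,\mathbb{C}^d)$ is the restriction of $\mathcal{J}$ to $\operatorname{Dom}(J)=\{u\in\ell^2(\mathbb{N}_0,\mathbb{C}^d):\mathcal{J}u\in\ell^2(\mathbb{N}_0,\mathbb{C}^d)\}$.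 Extended matrix generalized eigenvectors (emgev). For $z\in\mathbb{C}$, an emgev for $J$ and $z$ is a sequence $U=(U_n)_{n\ge-1}$ of complex $d\times d$ matrices with $A_{n-1}^*U_{n-1}+B_nU_n+A_nU_{n+1}=zU_n$ for all $n\ge0$. $Q(z)$ and $P(z)$ are the emgevs for $z$ with $Q_{-1}(z)=\operatorname{I}$, $Q_0(z)=0$, $P_{-1}(z)=0$, $P_0(z)=\operatorname{I}$. For a sequence $X$ of matrices and real $t\ge0$, with the operator norm $\|\cdot\|$ (Euclidean norm on $\mathbb{C}^d$), $\|X\|_{[0,t]}=\Big(\sum_{k=0}^{\lfloor t\rfloor}\|X_k\|^2+\{t\}\,\|X_{\lfloor t\rfloor+1}\|^2\Big)^{1/2}$, where $\{t\}=t-\lfloor t\rfloor$. Barrier. For non-empty $G\subset\mathbb{R}$, a function $\mathfrak{b}:G\times[1,+\infty)\to\mathbb{R}$ is a barrier (for $J$ on $G$) if for any $\lambda\in G$ and any two emgevs $U,V$ for $J$ and $\lambda$ with $\|U_{-1}\|^2+\|U_0\|^2=\|V_{-1}\|^2+\|V_0\|^2=1$ one has $\big(\|U\|_{[0,t]}/\|V\|_{[0,t]}\big)^2\le\mathfrak{b}(\lambda,t)$ for all $t\ge1$. J-L function. For self-adjoint $J$ and $\lambda\in\mathbb{R}$, $\ell_\lambda:(0,\infty)\to(0,\infty)$ is the unique function satisfying $\|P(\lambda)\|_{[0,\ell_\lambda(\epsilon)]}\|Q(\lambda)\|_{[0,\ell_\lambda(\epsilon)]}=\frac1{2\epsilon}$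 for all $\epsilon>0$ (it exists because $t\mapsto\|P(\lambda)\|_{[0,t]}\|Q(\lambda)\|_{[0,t]}$ is a continuous strictly increasing bijection of $(0,\infty)$). Matrix Weyl function. For self-adjoint $J$ and $z\in\mathbb{C}\setminus\mathbb{R}$, $W(z)$ is the unique complex $d\times d$ matrix such that the sequence $P(z)W(z)+Q(z)$ is square-summable in norm; equivalently $W(z)=\big(\langle(J-z\operatorname{I})^{-1}\delta_0(e_j),\delta_0(e_i)\rangle\big)_{i,j=1,\dots,d}$, where $\delta_0(v)$ is the sequence with value $v$ at position $0$ and $0$ elsewhere and $e_1,\dots,e_d$ is the standard basis. For a matrix $A$, $\operatorname{Im}A=\frac1{2i}(A-A^* )$; inequalities between Hermitian matrices are in the sense of quadratic forms. *)

theory Defs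
  imports "HOL-Analysis.Analysis"
begin

definition mat_adj :: "complex^'n^'m \<Rightarrow> complex^'m^'n" where
  "mat_adj M = (\<chi> i j. cnj (M $ j $ i))"

definition op_norm :: "complex^'n^'m \<Rightarrow> real" where
  "op_norm M = onorm (\<lambda>v. M *v v)"

(* linear in the first argument *)
definition cdot :: "complex^'n \<Rightarrow> complex^'n \<Rightarrow> complex" where
  "cdot v w = (\<Sum>i\<in>UNIV. v $ i * cnj (w $ i))"

(* "mat c" is c times the identity matrix, so "mat c ** M" is the scalar multiple c M. *)
definition mat_Im :: "complex^'n^'n \<Rightarrow> complex^'n^'n" where
  "mat_Im M = mat (1 / (2 * \<i>)) ** (M - mat_adj M)"

(* For Hermitian M the number cdot (M *v v) v is real, so taking Re loses nothing. *)
definition herm_le :: "complex^'n^'n \<Rightarrow> complex^'n^'n \<Rightarrow> bool" where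
  "herm_le M N \<longleftrightarrow> mat_adj M = M \<and> mat_adj N = N \<and>
     (\<forall>v. Re (cdot (M *v v) v) \<le> Re (cdot (N *v v) v))"


definition ell2 :: "(nat \<Rightarrow> complex^'d) set" where
  "ell2 = {u. summable (\<lambda>n. (norm (u n))\<^sup>2)}"

definition ell2_inner :: "(nat \<Rightarrow> complex^'d) \<Rightarrow> (nat \<Rightarrow> complex^'d) \<Rightarrow> complex" where
  "ell2_inner u v = (\<Sum>n. cdot (u n) (v n))"

definition ell2_norm :: "(nat \<Rightarrow> complex^'d) \<Rightarrow> real" where
  "ell2_norm u = sqrt (\<Sum>n. (norm (u n))\<^sup>2)"

definition ell2_dense :: "(nat \<Rightarrow> complex^'d) set \<Rightarrow> bool" where
  "ell2_dense D \<longleftrightarrow> D \<subseteq> ell2 \<and>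
     (\<forall>u\<in>ell2. \<forall>e>0. \<exists>v\<in>D. ell2_norm (\<lambda>n. u n - v n) < e)"

(* Unbounded operators in the Hilbert space are represented by their graphs. *)
definition graph_adjoint ::
  "((nat \<Rightarrow> complex^'d) \<times> (nat \<Rightarrow> complex^'d)) set \<Rightarrow>
   ((nat \<Rightarrow> complex^'d) \<times> (nat \<Rightarrow> complex^'d)) set" where
  "graph_adjoint T = {(v, w). v \<in> ell2 \<and> w \<in> ell2 \<and>
     (\<forall>(x, y)\<in>T. ell2_inner y v = ell2_inner x w)}"

definition self_adjoint_op ::
  "((nat \<Rightarrow> complex^'d) \<times> (nat \<Rightarrow> complex^'d)) set \<Rightarrow> bool" where
  "self_adjoint_op T \<longleftrightarrow> ell2_dense (Domain T) \<and> graph_adjoint T = T"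


fun jacobi_expr ::
  "(nat \<Rightarrow> complex^'d^'d) \<Rightarrow> (nat \<Rightarrow> complex^'d^'d) \<Rightarrow>
   (nat \<Rightarrow> complex^'d) \<Rightarrow> nat \<Rightarrow> complex^'d" where
  "jacobi_expr A B u 0 = B 0 *v u 0 + A 0 *v u 1"
| "jacobi_expr A B u (Suc n) =
     mat_adj (A n) *v u n + B (Suc n) *v u (Suc n) + A (Suc n) *v u (Suc (Suc n))"

definition jacobi_dom ::
  "(nat \<Rightarrow> complex^'d^'d) \<Rightarrow> (nat \<Rightarrow> complex^'d^'d) \<Rightarrow> (nat \<Rightarrow> complex^'d) set" where
  "jacobi_dom A B = {u \<in> ell2. jacobi_expr A B u \<in> ell2}"

definition jacobi_op ::
  "(nat \<Rightarrow> complex^'d^'d) \<Rightarrow> (nat \<Rightarrow> complex^'d^'d) \<Rightarrow>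
   ((nat \<Rightarrow> complex^'d) \<times> (nat \<Rightarrow> complex^'d)) set" where
  "jacobi_op A B = {(u, jacobi_expr A B u) | u. u \<in> jacobi_dom A B}"


(* prevA A n is A_{n-1}, with the convention A_{-1} = -I *)
definition prevA :: "(nat \<Rightarrow> complex^'d^'d) \<Rightarrow> nat \<Rightarrow> complex^'d^'d" where
  "prevA A n = (case n of 0 \<Rightarrow> - mat 1 | Suc m \<Rightarrow> A m)"

(* A sequence (U_n) indexed by n >= -1 is encoded by U :: nat => _ with U k standing for U_{k-1}:
   U 0 is U_{-1}, U (Suc 0) is U_0, and the part with n >= 0 is n |-> U (Suc n). *)
definition emgev ::
  "(nat \<Rightarrow> complex^'d^'d) \<Rightarrow> (nat \<Rightarrow> complex^'d^'d) \<Rightarrow> complex \<Rightarrow>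
   (nat \<Rightarrow> complex^'d^'d) \<Rightarrow> bool" where
  "emgev A B z U \<longleftrightarrow> (\<forall>n.
     mat_adj (prevA A n) ** U n + B n ** U (Suc n) + A n ** U (Suc (Suc n))
       = mat z ** U (Suc n))"

definition emgevQ ::
  "(nat \<Rightarrow> complex^'d^'d) \<Rightarrow> (nat \<Rightarrow> complex^'d^'d) \<Rightarrow> complex \<Rightarrow> nat \<Rightarrow> complex^'d^'d" where
  "emgevQ A B z = (THE U. emgev A B z U \<and> U 0 = mat 1 \<and> U (Suc 0) = 0)"

definition emgevP ::
  "(nat \<Rightarrow> complex^'d^'d) \<Rightarrow> (nat \<Rightarrow> complex^'d^'d) \<Rightarrow> complex \<Rightarrow> nat \<Rightarrow> complex^'d^'d" where
  "emgevP A B z = (THE U. emgev A B z U \<and> U 0 = 0 \<and> U (Suc 0) = mat 1)"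

(* X is shifted as above, so that X (Suc k) is the entry with index k; the entry with
   index -1 does not contribute. *)
definition trunc_norm :: "(nat \<Rightarrow> complex^'d^'d) \<Rightarrow> real \<Rightarrow> real" where
  "trunc_norm X t = sqrt ((\<Sum>k\<le>nat \<lfloor>t\<rfloor>. (op_norm (X (Suc k)))\<^sup>2)
     + frac t * (op_norm (X (Suc (nat \<lfloor>t\<rfloor> + 1))))\<^sup>2)"

definition barrier ::
  "(nat \<Rightarrow> complex^'d^'d) \<Rightarrow> (nat \<Rightarrow> complex^'d^'d) \<Rightarrow> real set \<Rightarrow>
   (real \<Rightarrow> real \<Rightarrow> real) \<Rightarrow> bool" where
  "barrier A B G b \<longleftrightarrow> (\<forall>l\<in>G. \<forall>U V.
     emgev A B (of_real l) U \<longrightarrow> emgev A B (of_real l) V \<longrightarrow>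
     (op_norm (U 0))\<^sup>2 + (op_norm (U (Suc 0)))\<^sup>2 = 1 \<longrightarrow>
     (op_norm (V 0))\<^sup>2 + (op_norm (V (Suc 0)))\<^sup>2 = 1 \<longrightarrow>
     (\<forall>t\<ge>1. (trunc_norm U t / trunc_norm V t)\<^sup>2 \<le> b l t))"

definition jl_fun ::
  "(nat \<Rightarrow> complex^'d^'d) \<Rightarrow> (nat \<Rightarrow> complex^'d^'d) \<Rightarrow> real \<Rightarrow> real \<Rightarrow> real" where
  "jl_fun A B l \<epsilon> = (THE t. t > 0 \<and>
     trunc_norm (emgevP A B (of_real l)) t * trunc_norm (emgevQ A B (of_real l)) t = 1 / (2 * \<epsilon>))"

definition weyl ::
  "(nat \<Rightarrow> complex^'d^'d) \<Rightarrow> (nat \<Rightarrow> complex^'d^'d) \<Rightarrow> complex \<Rightarrow> complex^'d^'d" where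
  "weyl A B z = (THE W. summable (\<lambda>n. (op_norm (emgevP A B z n ** W + emgevQ A B z n))\<^sup>2))"

end

(* With z = l + i eps and W = W(z), the symmetry of J turns square-summability of U = P(z) W + Q(z) into
   eps * sum_k |U_k v|^2 = Im <W v, v>. Variation of constants compares U with the solution
   Y = P(l) W + Q(l) at the real energy: since 2 eps |P|_[0,t] |Q|_[0,t] = 1 at t = ell_l(eps), one gets
   |Y C|_[0,t] <= 2 |U C|_[0,t] for every matrix C. The barrier bounds |Y C|_[0,t]^2 from below by
   (|C|^2 + |W C|^2) |P|_[0,t] |Q|_[0,t] / beta. Taking C to be the projection onto a unit vector gives the
   bound on Im W, and C = I together with tr Im W <= d |W| gives 1 + |W|^2 <= 8 d beta |W|. *)
theory Submission
  imports Defs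
begin

section \<open>Complex matrices and the operator norm\<close>

text \<open>Variation of constants expresses \<open>Y\<close> through \<open>U\<close>, with the
  kernel taken at the real energy. The error term then contains \<open>U\<close> and not
  \<open>Y\<close>, so neither iteration nor smallness is needed. The two halves of the kernel
  contribute \<open>eps |P| |Q| = 1/2\<close> each, which gives the factor 1 + 1 = 2; the 8 is its
  square times the 2 in \<open>2 eps |P| |Q| = 1\<close>. Since matrices do not commute, constancy
  of the scalar Wronskian is replaced by identities for the kernel
  \<open>P_n Q_k^* - Q_n P_k^*\<close>. The truncated norms add up operator norms, whereas symmetry
  only controls sums of vector norms. A rank one \<open>C\<close> makes the two equal;
  \<open>C = I\<close> requires the Hilbert-Schmidt norm, hence the dimension \<open>d\<close>.
  \<open>P\<close>, \<open>Q\<close>, \<open>W\<close> and \<open>ell\<close> are definite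
  descriptions and say nothing before existence and uniqueness are proved: for \<open>P\<close>,
  \<open>Q\<close> by invertibility of the \<open>A n\<close>, for \<open>W\<close> by limits of
  finite sections and by the absence of non-real eigenvalues, for \<open>ell\<close> by strict
  growth and unboundedness of \<open>|P| |Q|\<close>.\<close>

lemma matrix_add_distribs:
  fixes X Y Z :: "complex^'d^'d"
  shows "X ** (Y + Z) = X ** Y + X ** Z" "(X + Y) ** Z = X ** Z + Y ** Z"
    "X ** (Y - Z) = X ** Y - X ** Z" "(X - Y) ** Z = X ** Z - Y ** Z"
    "(- X) ** Y = - (X ** Y)" "X ** (- Y) = - (X ** Y)"
  by (simp_all add: matrix_matrix_mult_def vec_eq_iff sum.distrib sum_subtractf sum_negf algebra_simps)

lemma matrix_sum_distribs:
  fixes X Z :: "complex^'d^'d" and Y :: "'i \<Rightarrow> complex^'d^'d"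
  shows "X ** (\<Sum>i\<in>S. Y i) = (\<Sum>i\<in>S. X ** Y i)" "(\<Sum>i\<in>S. Y i) ** Z = (\<Sum>i\<in>S. Y i ** Z)"
  by (induction S rule: infinite_finite_induct) (simp_all add: matrix_add_distribs)

lemma mat_mul_component:
  fixes X :: "complex^'d^'d"
  shows "(mat c ** X) $ i $ j = c * X $ i $ j"
  by (simp add: matrix_matrix_mult_def mat_def if_distrib[where f="\<lambda>x. x * _"] cong: if_cong)

lemma mul_mat_component:
  fixes X :: "complex^'d^'d"
  shows "(X ** mat c) $ i $ j = c * X $ i $ j"
  by (simp add: matrix_matrix_mult_def mat_def if_distrib[where f="\<lambda>x. _ * x"] mult.commute cong: if_cong)

lemma mat_central:
  fixes X :: "complex^'d^'d"
  shows "X ** mat c = mat c ** X"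
  by (simp add: vec_eq_iff mat_mul_component mul_mat_component)

lemma mat_mul_left_commute:
  fixes X Y :: "complex^'d^'d"
  shows "X ** (mat c ** Y) = mat c ** (X ** Y)"
  by (metis mat_central matrix_mul_assoc)

lemma mat_mul_vec:
  fixes v :: "complex^'d"
  shows "mat c *v v = c *s v"
  by (simp add: vec_eq_iff matrix_vector_mult_def mat_def vector_scalar_mult_def
      if_distrib[where f="\<lambda>x. x * _"] cong: if_cong)

lemma mat_diff_mul:
  fixes X :: "complex^'d^'d"
  shows "mat (c - e) ** X = mat c ** X - mat e ** X"
  by (simp add: vec_eq_iff mat_mul_component algebra_simps)

lemma mat_adj_simps:
  fixes X Y :: "complex^'d^'d"
  shows "mat_adj (mat_adj X) = X" "mat_adj (X + Y) = mat_adj X + mat_adj Y"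
    "mat_adj (X - Y) = mat_adj X - mat_adj Y" "mat_adj (- X) = - mat_adj X"
    "mat_adj (mat c :: complex^'d^'d) = mat (cnj c)" "mat_adj (0 :: complex^'d^'d) = 0"
    "mat_adj (X ** Y) = mat_adj Y ** mat_adj X"
  by (auto simp add: mat_adj_def vec_eq_iff mat_def matrix_matrix_mult_def mult.commute)

section \<open>The sesquilinear form and adjoints\<close>

lemma cdot_simps:
  fixes u v w :: "complex^'d"
  shows "cdot (u + v) w = cdot u w + cdot v w" "cdot w (u + v) = cdot w u + cdot w v"
    "cdot (u - v) w = cdot u w - cdot v w" "cdot w (u - v) = cdot w u - cdot w v"
    "cdot (c *s u) w = c * cdot u w" "cdot w (c *s u) = cnj c * cdot w u"
    "cdot 0 w = 0" "cdot w 0 = 0"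
  by (simp_all add: cdot_def sum.distrib sum_subtractf sum_distrib_left algebra_simps)

lemma cdot_commute: "cdot u v = cnj (cdot v u)"
  by (simp add: cdot_def mult.commute)

lemma Re_cdot: "Re (cdot u v) = u \<bullet> v"
  by (simp add: cdot_def inner_vec_def inner_complex_def)

lemma cdot_self: "cdot v v = of_real ((norm v)\<^sup>2)"
proof -
  have "Im (cdot v v) = 0"
    using cdot_commute[of v v] by (simp add: complex_eq_iff)
  moreover have "Re (cdot v v) = (norm v)\<^sup>2"
    by (simp add: Re_cdot power2_norm_eq_inner)
  ultimately show ?thesis by (simp add: complex_eq_iff)
qed

lemma norm_vector_smult: "norm (c *s v) = cmod c * norm (v :: complex^'d)"
  by (simp add: norm_vec_def L2_set_right_distrib norm_mult)

lemma cdot_Cauchy_Schwarz: "cmod (cdot u v) \<le> norm u * norm v"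
proof (cases "cdot u v = 0")
  case False
  define c where "c = cnj (sgn (cdot u v))"
  have c: "cmod c = 1" using False by (simp add: c_def norm_sgn)
  have "cmod (cdot u v) = Re (c * cdot u v)"
    by (simp add: c_def sgn_eq complex_mult_cnj cmod_def power2_eq_square divide_simps)
  also have "\<dots> = (c *s u) \<bullet> v" by (simp add: cdot_simps flip: Re_cdot)
  also have "\<dots> \<le> norm (c *s u) * norm v" by (rule norm_cauchy_schwarz)
  finally show ?thesis by (simp add: norm_vector_smult c)
qed simp

lemma cdot_mat_adj:
  fixes X :: "complex^'n^'m"
  shows "cdot (mat_adj X *v u) v = cdot u (X *v v)"
proof -
  have "cdot (mat_adj X *v u) v = (\<Sum>i\<in>UNIV. \<Sum>j\<in>UNIV. cnj (X $ j $ i) * u $ j * cnj (v $ i))"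
    by (simp add: cdot_def mat_adj_def matrix_vector_mult_def sum_distrib_right)
  also have "\<dots> = (\<Sum>j\<in>UNIV. \<Sum>i\<in>UNIV. cnj (X $ j $ i) * u $ j * cnj (v $ i))"
    by (rule sum.swap)
  finally show ?thesis
    by (simp add: cdot_def matrix_vector_mult_def sum_distrib_left mult_ac)
qed

section \<open>The operator norm\<close>

lemma bounded_linear_matrix_vector_mult: "bounded_linear (\<lambda>v. (X :: complex^'n^'m) *v v)"
  using linear_conv_bounded_linear matrix_vector_mul_linear by blast

lemma norm_le_op_norm: "norm (X *v v) \<le> op_norm X * norm v"
  unfolding op_norm_def by (rule onorm[OF bounded_linear_matrix_vector_mult])

lemma op_norm_nonneg [simp]: "0 \<le> op_norm X"
  unfolding op_norm_def by (rule onorm_pos_le[OF bounded_linear_matrix_vector_mult])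

lemma op_norm_le: "(\<And>v. norm (X *v v) \<le> c * norm v) \<Longrightarrow> op_norm X \<le> c"
  unfolding op_norm_def by (rule onorm_le)

lemma op_norm_mult: "op_norm (X ** Y) \<le> op_norm X * op_norm (Y :: complex^'d^'d)"
  unfolding op_norm_def
  using onorm_compose[OF bounded_linear_matrix_vector_mult bounded_linear_matrix_vector_mult, of X Y]
  by (simp add: o_def matrix_vector_mul_assoc)

lemma op_norm_triangle: "op_norm (X + Y) \<le> op_norm X + op_norm Y"
  unfolding op_norm_def matrix_vector_mult_add_rdistrib
  by (rule onorm_triangle[OF bounded_linear_matrix_vector_mult bounded_linear_matrix_vector_mult])

lemma matrix_vector_mult_minus_left: "(- X) *v v = - ((X :: complex^'n^'m) *v v)"
  by (simp add: vec_eq_iff matrix_vector_mult_def sum_negf)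

lemma op_norm_minus: "op_norm (- X) = op_norm (X :: complex^'n^'m)"
  by (simp add: op_norm_def matrix_vector_mult_minus_left onorm_neg)

lemma op_norm_zero [simp]: "op_norm 0 = 0"
  by (simp add: op_norm_def onorm_zero)

lemma op_norm_eq_0 [simp]: "op_norm X = 0 \<longleftrightarrow> X = 0"
proof
  assume "op_norm X = 0"
  then have "X *v v = 0 *v v" for v using norm_le_op_norm[of X v] by simp
  then show "X = 0" by (subst matrix_eq) blast
qed simp

lemma op_norm_mat [simp]: "op_norm (mat c :: complex^'d^'d) = cmod c"
proof (rule antisym)
  show "op_norm (mat c :: complex^'d^'d) \<le> cmod c"
    by (rule op_norm_le) (simp add: mat_mul_vec norm_vector_smult)
  show "cmod c \<le> op_norm (mat c :: complex^'d^'d)"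
    using norm_le_op_norm[of "mat c" "axis (undefined :: 'd) (1 :: complex)"]
    by (simp add: mat_mul_vec norm_vector_smult norm_axis_1)
qed

lemma op_norm_sum: "op_norm (\<Sum>i\<in>S. X i) \<le> (\<Sum>i\<in>S. op_norm (X i))"
  by (induction S rule: infinite_finite_induct) (auto intro: order_trans[OF op_norm_triangle])

lemma op_norm_adj_le: "op_norm (mat_adj X) \<le> op_norm (X :: complex^'d^'d)"
proof (rule op_norm_le)
  fix v :: "complex^'d"
  let ?w = "mat_adj X *v v"
  have "(norm ?w)\<^sup>2 = cmod (cdot v (X *v ?w))"
    by (metis cdot_mat_adj cdot_self norm_of_real abs_of_nonneg zero_le_power2)
  also have "\<dots> \<le> norm v * (op_norm X * norm ?w)"
    by (rule order_trans[OF cdot_Cauchy_Schwarz]) (intro mult_left_mono norm_le_op_norm norm_ge_zero)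
  finally have "norm ?w * norm ?w \<le> (op_norm X * norm v) * norm ?w"
    by (simp add: power2_eq_square mult_ac)
  then show "norm ?w \<le> op_norm X * norm v"
    by (cases "?w = 0") (simp_all add: mult_le_cancel_right)
qed

lemma op_norm_adj [simp]: "op_norm (mat_adj X) = op_norm (X :: complex^'d^'d)"
  by (metis antisym mat_adj_simps(1) op_norm_adj_le)

lemma norm_column_le_op_norm: "norm (X *v axis i 1) \<le> op_norm X"
  using norm_le_op_norm[of X "axis i 1"] by (simp add: norm_axis_1)

text \<open>The right-hand side is the squared Hilbert-Schmidt norm: expand \<open>v\<close> in the
  standard basis and apply Cauchy-Schwarz. It is the bridge from vectorwise square sums to operator
  norms.\<close>

lemma op_norm_sq_le_columns:
  "(op_norm (X :: complex^'d^'d))\<^sup>2 \<le> (\<Sum>i\<in>UNIV. (norm (X *v axis i 1))\<^sup>2)"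
proof -
  let ?c = "\<lambda>i. norm (X *v axis i 1)"
  have "norm (X *v v) \<le> L2_set ?c UNIV * norm v" for v
  proof -
    have "X *v v = (\<Sum>i\<in>UNIV. v $ i *s (X *v axis i 1))"
      by (simp add: vec_eq_iff matrix_vector_mult_def axis_def if_distrib mult.commute cong: if_cong)
    then have "norm (X *v v) \<le> (\<Sum>i\<in>UNIV. \<bar>?c i\<bar> * \<bar>norm (v $ i)\<bar>)"
      by (simp add: sum_norm_le norm_vector_smult mult.commute)
    also have "\<dots> \<le> L2_set ?c UNIV * L2_set (\<lambda>i. norm (v $ i)) UNIV" by (rule L2_set_mult_ineq)
    finally show ?thesis by (simp add: norm_vec_def)
  qed
  then have "op_norm X \<le> L2_set ?c UNIV" by (rule op_norm_le)
  then have "(op_norm X)\<^sup>2 \<le> (L2_set ?c UNIV)\<^sup>2" by (intro power_mono) simp_all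
  then show ?thesis by (simp add: L2_set_def sum_nonneg)
qed

text \<open>The matrix \<open>v v^*\<close>; for a unit vector it is the orthogonal projection onto
  the line through \<open>v\<close>.\<close>

definition outer_proj :: "complex^'d \<Rightarrow> complex^'d^'d" where
  "outer_proj v = (\<chi> i j. v $ i * cnj (v $ j))"

lemma outer_proj_vec: "outer_proj v *v w = cdot w v *s v"
  by (simp add: vec_eq_iff outer_proj_def matrix_vector_mult_def cdot_def sum_distrib_left mult_ac)

text \<open>A rank one product has only one direction to stretch. It turns the truncated norm of a
  matrix solution into that of the vector solution applied to \<open>v\<close>, without
  loss.\<close>

lemma op_norm_mult_outer_proj:
  assumes "norm v = 1"
  shows "op_norm (X ** outer_proj v) = norm (X *v v)"
proof (rule antisym)
  have *: "(X ** outer_proj v) *v w = cdot w v *s (X *v v)" for w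
    by (simp add: outer_proj_vec vector_scalar_commute flip: matrix_vector_mul_assoc)
  show "op_norm (X ** outer_proj v) \<le> norm (X *v v)"
  proof (rule op_norm_le)
    fix w
    have "cmod (cdot w v) \<le> norm w" using cdot_Cauchy_Schwarz[of w v] assms by simp
    then show "norm ((X ** outer_proj v) *v w) \<le> norm (X *v v) * norm w"
      by (simp add: * norm_vector_smult mult.commute[of _ "norm w"] mult_right_mono)
  qed
  show "norm (X *v v) \<le> op_norm (X ** outer_proj v)"
    using norm_le_op_norm[of "X ** outer_proj v" v] assms
    by (simp add: * cdot_self)
qed

lemma mat_adj_mat_Im: "mat_adj (mat_Im X) = mat_Im X"
  by (auto simp add: vec_eq_iff mat_Im_def mat_adj_def mat_mul_component complex_eq_iff Re_divide Im_divide field_simps)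

lemma cdot_mat_Im: "cdot (mat_Im X *v v) v = of_real (Im (cdot (X *v v) v))"
proof -
  have "mat_Im X *v v = (1 / (2 * \<i>)) *s (X *v v - mat_adj X *v v)"
    by (simp add: mat_Im_def mat_mul_vec matrix_vector_mult_diff_rdistrib flip: matrix_vector_mul_assoc)
  then have "cdot (mat_Im X *v v) v = (cdot (X *v v) v - cnj (cdot (X *v v) v)) / (2 * \<i>)"
    by (simp only: cdot_simps cdot_mat_adj) (simp add: cdot_commute[of v] diff_divide_distrib)
  then show ?thesis by (simp add: complex_diff_cnj complex_eq_iff)
qed

lemma matrix_inv:
  fixes X :: "complex^'d^'d"
  assumes "det X \<noteq> 0"
  shows "X ** matrix_inv X = mat 1" "matrix_inv X ** X = mat 1"
proof -
  obtain Y where "X ** Y = mat 1 \<and> Y ** X = mat 1"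
    using assms by (metis invertible_det_nz invertible_def)
  then have "X ** matrix_inv X = mat 1 \<and> matrix_inv X ** X = mat 1"
    unfolding matrix_inv_def by (rule someI)
  then show "X ** matrix_inv X = mat 1" "matrix_inv X ** X = mat 1" by auto
qed

lemma matrix_mul_left_cancel:
  fixes X Y Z :: "complex^'d^'d"
  assumes "det X \<noteq> 0" "X ** Y = X ** Z"
  shows "Y = Z"
  by (metis assms matrix_inv(2) matrix_mul_assoc matrix_mul_lid)

lemma mat_1_neq_0: "(mat 1 :: complex^'d^'d) \<noteq> 0"
proof
  assume "(mat 1 :: complex^'d^'d) = 0"
  then have "op_norm (mat 1 :: complex^'d^'d) = 0" by (simp only: op_norm_zero)
  then show False by simp
qed

lemma norm_le_sum_norm_nth: "norm (v :: 'a::real_normed_vector^'n) \<le> (\<Sum>i\<in>UNIV. norm (v $ i))"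
  unfolding norm_vec_def by (rule L2_set_le_sum) simp

text \<open>Needed for compactness only: closed balls are compact in the norm of the matrix type,
  while the bounds on Weyl matrices come in the operator norm. The size of the constant does not
  matter.\<close>

lemma norm_le_card_op_norm: "norm X \<le> (real CARD('d))\<^sup>2 * op_norm (X :: complex^'d^'d)"
proof -
  have entry: "norm (X $ i $ j) \<le> op_norm X" for i j
  proof -
    have "X $ i $ j = (X *v axis j 1) $ i"
      by (simp add: matrix_vector_mult_def axis_def if_distrib[where f="\<lambda>x. _ * x"] cong: if_cong)
    then have "norm (X $ i $ j) \<le> norm (X *v axis j 1)" by (simp only: Finite_Cartesian_Product.norm_nth_le)
    then show ?thesis using norm_column_le_op_norm by (rule order_trans)
  qed
  have "norm X \<le> (\<Sum>i\<in>UNIV. norm (X $ i))" by (rule norm_le_sum_norm_nth)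
  also have "\<dots> \<le> (\<Sum>i\<in>UNIV. \<Sum>j\<in>UNIV. norm (X $ i $ j))"
    by (intro sum_mono norm_le_sum_norm_nth)
  also have "\<dots> \<le> (\<Sum>i\<in>(UNIV :: 'd set). \<Sum>j\<in>(UNIV :: 'd set). op_norm X)"
    by (intro sum_mono entry)
  finally show ?thesis by (simp add: power2_eq_square)
qed

lemma tendsto_matrix_vector_mult:
  fixes W :: "'i \<Rightarrow> complex^'d^'d"
  assumes "(W \<longlongrightarrow> W') F"
  shows "((\<lambda>i. W i *v v) \<longlongrightarrow> W' *v v) F"
  unfolding matrix_vector_mult_def
  by (rule tendsto_vec_lambda, rule tendsto_sum, rule tendsto_mult,
      rule tendsto_vec_nth, rule tendsto_vec_nth, rule assms, rule tendsto_const)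

section \<open>Generalized eigenvectors and variation of constants\<close>

lemmas matrix_distribs = matrix_add_distribs matrix_sum_distribs matrix_mul_assoc[symmetric]

locale block_jacobi =
  fixes A B :: "nat \<Rightarrow> complex^'d^'d"
  assumes det_A: "\<And>n. det (A n) \<noteq> 0"
    and adj_B: "\<And>n. mat_adj (B n) = B n"
begin

section \<open>Existence and uniqueness for the three-term recurrence\<close>

lemma emgev_step:
  assumes "emgev A B z U"
  shows "A n ** U (Suc (Suc n)) = (mat z - B n) ** U (Suc n) - mat_adj (prevA A n) ** U n"
proof -
  have "mat_adj (prevA A n) ** U n + B n ** U (Suc n) + A n ** U (Suc (Suc n)) = mat z ** U (Suc n)"
    using assms by (simp add: emgev_def)
  then show ?thesis by (simp add: matrix_add_distribs algebra_simps)
qed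

lemma emgev_unique:
  assumes "emgev A B z U" "emgev A B z V" "U 0 = V 0" "U (Suc 0) = V (Suc 0)"
  shows "U = V"
proof -
  have "U n = V n \<and> U (Suc n) = V (Suc n)" for n
  proof (induction n)
    case (Suc n)
    then have "A n ** U (Suc (Suc n)) = A n ** V (Suc (Suc n))"
      by (simp add: emgev_step[OF assms(1)] emgev_step[OF assms(2)])
    then show ?case using Suc matrix_mul_left_cancel[OF det_A] by blast
  qed (use assms in auto)
  then show ?thesis by auto
qed

fun emgev_from :: "complex \<Rightarrow> complex^'d^'d \<Rightarrow> complex^'d^'d \<Rightarrow> nat \<Rightarrow> complex^'d^'d" where
  "emgev_from z U0 U1 0 = U0"
| "emgev_from z U0 U1 (Suc 0) = U1"
| "emgev_from z U0 U1 (Suc (Suc n)) = matrix_inv (A n) **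
     ((mat z - B n) ** emgev_from z U0 U1 (Suc n) - mat_adj (prevA A n) ** emgev_from z U0 U1 n)"

lemma emgev_emgev_from: "emgev A B z (emgev_from z U0 U1)"
  unfolding emgev_def by (simp add: matrix_mul_assoc matrix_inv det_A matrix_add_distribs)

lemma emgev_from_unique:
  "(THE U. emgev A B z U \<and> U 0 = U0 \<and> U (Suc 0) = U1) = emgev_from z U0 U1"
  by (rule the_equality) (auto intro: emgev_unique simp: emgev_emgev_from)

lemma emgevQ_eq: "emgevQ A B z = emgev_from z (mat 1) 0"
  and emgevP_eq: "emgevP A B z = emgev_from z 0 (mat 1)"
  unfolding emgevQ_def emgevP_def by (rule emgev_from_unique)+

lemma emgev_P: "emgev A B z (emgevP A B z)"
    and emgev_Q: "emgev A B z (emgevQ A B z)"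
    and emgevP_init [simp]: "emgevP A B z 0 = 0" "emgevP A B z (Suc 0) = mat 1"
    and emgevQ_init [simp]: "emgevQ A B z 0 = mat 1" "emgevQ A B z (Suc 0) = 0"
  by (auto simp: emgevQ_eq emgevP_eq emgev_emgev_from)

lemma emgev_lincomb:
  assumes "emgev A B z U" "emgev A B z V"
  shows "emgev A B z (\<lambda>n. U n ** C + V n ** D)"
  unfolding emgev_def
proof
  fix n
  let ?L = "\<lambda>U. mat_adj (prevA A n) ** U n + B n ** U (Suc n) + A n ** U (Suc (Suc n))"
  have "?L (\<lambda>n. U n ** C + V n ** D) = ?L U ** C + ?L V ** D"
    by (simp add: matrix_distribs algebra_simps)
  also have "\<dots> = mat z ** (U (Suc n) ** C + V (Suc n) ** D)"
    using assms by (simp add: emgev_def matrix_distribs)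
  finally show "?L (\<lambda>n. U n ** C + V n ** D) = mat z ** (U (Suc n) ** C + V (Suc n) ** D)" .
qed

text \<open>The Cauchy kernel of the recurrence at a real energy: a solution in \<open>n\<close>
  that vanishes at \<open>n = k\<close>. The adjoints sit on the second index, which makes the
  kernel anti-Hermitian under exchange of the indices.\<close>

definition green_kernel :: "real \<Rightarrow> nat \<Rightarrow> nat \<Rightarrow> complex^'d^'d" where
  "green_kernel l n k = emgevP A B (of_real l) n ** mat_adj (emgevQ A B (of_real l) k)
     - emgevQ A B (of_real l) n ** mat_adj (emgevP A B (of_real l) k)"

lemma emgev_green_kernel: "emgev A B (of_real l) (\<lambda>n. green_kernel l n k)"
proof -
  have "(\<lambda>n. green_kernel l n k) = (\<lambda>n. emgevP A B (of_real l) n ** mat_adj (emgevQ A B (of_real l) k)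
     + emgevQ A B (of_real l) n ** (- mat_adj (emgevP A B (of_real l) k)))"
    by (simp add: green_kernel_def matrix_distribs)
  then show ?thesis by (simp only: emgev_lincomb[OF emgev_P emgev_Q])
qed

lemma adj_green_kernel: "mat_adj (green_kernel l n k) = - green_kernel l k n"
  by (simp add: green_kernel_def mat_adj_simps)

text \<open>These are the matrix Wronskian identities. They have to be carried through one
  induction, because each new diagonal entry is computed from the previous off-diagonal ones. A
  one-sided inverse of a square matrix is two-sided, so factors can change sides; anti-Hermiticity
  then exchanges the indices.\<close>

lemma green_kernel_invariants:
  "green_kernel l n n = 0 \<and> green_kernel l (Suc n) (Suc n) = 0 \<and>
   prevA A n ** green_kernel l (Suc n) n = - mat 1"
proof (induction n)
  case 0
  show ?case by (simp add: green_kernel_def prevA_def mat_adj_simps matrix_distribs)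
next
  case (Suc n)
  let ?K = "green_kernel l" and ?L = "mat (of_real l) - B n"
  have L: "mat_adj ?L = ?L" by (simp add: mat_adj_simps adj_B)
  have step: "A n ** ?K (Suc (Suc n)) k = ?L ** ?K (Suc n) k - mat_adj (prevA A n) ** ?K n k" for k
    by (rule emgev_step[OF emgev_green_kernel])
  have K1: "?K (Suc n) n ** prevA A n = - mat 1"
  proof -
    have "prevA A n ** (- ?K (Suc n) n) = mat 1" using Suc by (simp add: matrix_distribs)
    then have "(- ?K (Suc n) n) ** prevA A n = mat 1" by (rule matrix_left_right_inverse[THEN iffD1])
    then show ?thesis by (simp add: matrix_distribs minus_equation_iff[of _ "mat 1"])
  qed
  have K1': "mat_adj (prevA A n) ** ?K n (Suc n) = mat 1"
  proof -
    have "mat_adj (prevA A n) ** ?K n (Suc n) = - mat_adj (?K (Suc n) n ** prevA A n)"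
      by (simp add: mat_adj_simps adj_green_kernel matrix_distribs)
    then show ?thesis by (simp add: K1 mat_adj_simps)
  qed
  have K2: "A n ** ?K (Suc (Suc n)) (Suc n) = - mat 1"
    using Suc by (simp add: step K1')
  have K2': "?K (Suc n) (Suc (Suc n)) ** mat_adj (A n) = mat 1"
  proof -
    have "mat_adj (A n ** ?K (Suc (Suc n)) (Suc n)) = mat_adj (- mat 1)" by (simp only: K2)
    then have "- (?K (Suc n) (Suc (Suc n)) ** mat_adj (A n)) = - mat 1"
      by (simp add: mat_adj_simps adj_green_kernel matrix_distribs)
    then show ?thesis by simp
  qed
  have K3: "?K n (Suc (Suc n)) ** mat_adj (A n) = ?K n (Suc n) ** ?L"
  proof -
    have "A n ** ?K (Suc (Suc n)) n = ?L ** ?K (Suc n) n" using Suc by (simp add: step)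
    then have "mat_adj (A n ** ?K (Suc (Suc n)) n) = mat_adj (?L ** ?K (Suc n) n)" by (simp only:)
    then have "- ?K n (Suc (Suc n)) ** mat_adj (A n) = - ?K n (Suc n) ** ?L"
      by (simp only: mat_adj_simps(7) L adj_green_kernel)
    then show ?thesis unfolding matrix_add_distribs(5) by (rule neg_equal_iff_equal[THEN iffD1])
  qed
  \<comment> \<open>Multiplying by \<open>A n\<close> on the left and its adjoint on the right lets
    the recurrence act on both indices. What remains is \<open>?L - ?L\<close>, and the invertible
    outer factors can be removed.\<close>
  have "A n ** ?K (Suc (Suc n)) (Suc (Suc n)) ** mat_adj (A n)
      = ?L ** (?K (Suc n) (Suc (Suc n)) ** mat_adj (A n))
        - mat_adj (prevA A n) ** (?K n (Suc (Suc n)) ** mat_adj (A n))"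
    by (simp add: step matrix_distribs)
  also have "\<dots> = ?L - (mat_adj (prevA A n) ** ?K n (Suc n)) ** ?L"
    by (simp only: K2' K3 matrix_mul_rid matrix_mul_assoc)
  finally have "A n ** ?K (Suc (Suc n)) (Suc (Suc n)) ** mat_adj (A n) = 0" by (simp add: K1')
  then have "A n ** ?K (Suc (Suc n)) (Suc (Suc n)) ** (mat_adj (A n) ** mat_adj (matrix_inv (A n))) = 0"
    by (simp only: matrix_mul_assoc times0_left)
  then have "A n ** ?K (Suc (Suc n)) (Suc (Suc n)) = A n ** 0"
    by (simp add: matrix_inv det_A mat_adj_simps flip: mat_adj_simps(7))
  then have "?K (Suc (Suc n)) (Suc (Suc n)) = 0" by (rule matrix_mul_left_cancel[OF det_A])
  then show ?case using Suc K2 by (simp add: prevA_def)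
qed

lemma green_kernel_diag [simp]: "green_kernel l n n = 0"
  using green_kernel_invariants by blast

lemma prevA_green_kernel: "mat_adj (prevA A n) ** green_kernel l n (Suc n) = mat 1"
proof -
  have "prevA A n ** (- green_kernel l (Suc n) n) = mat 1"
    using green_kernel_invariants[of l n] by (simp add: matrix_distribs)
  then have "(- green_kernel l (Suc n) n) ** prevA A n = mat 1"
    by (rule matrix_left_right_inverse[THEN iffD1])
  then have "mat_adj ((- green_kernel l (Suc n) n) ** prevA A n) = mat 1" by (simp add: mat_adj_simps)
  then show ?thesis by (simp add: mat_adj_simps adj_green_kernel)
qed

text \<open>The kernel sum has zero initial data and satisfies the recurrence at energy
  \<open>l\<close> with source \<open>- X (Suc n)\<close>. Scaled by \<open>z - l\<close>, it
  cancels the defect \<open>(z - l) X\<close> that \<open>X\<close> has at energy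
  \<open>l\<close>.\<close>

lemma emgev_variation_of_constants:
  assumes X: "emgev A B z X" and Y: "emgev A B (of_real l) Y"
    and init: "X 0 = Y 0" "X (Suc 0) = Y (Suc 0)"
  shows "Y n = X n + mat (z - of_real l) ** (\<Sum>k\<in>{1..<n}. green_kernel l n k ** X k)"
proof -
  let ?K = "green_kernel l" and ?c = "mat (z - of_real l) :: complex^'d^'d"
  define S where "S n = (\<Sum>k\<in>{1..<n}. ?K n k ** X k)" for n
  have S: "mat_adj (prevA A n) ** S n + B n ** S (Suc n) + A n ** S (Suc (Suc n))
      = mat (of_real l) ** S (Suc n) - X (Suc n)" for n
  proof -
    let ?I = "{1..<Suc (Suc n)}"
    have S1: "S (Suc n) = (\<Sum>k\<in>?I. ?K (Suc n) k ** X k)" by (simp add: S_def)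
    \<comment> \<open>All three sums are brought to the range \<open>?I\<close>. The added diagonal
      terms vanish; the only surplus is \<open>k = Suc n\<close> in the sum at \<open>n\<close>, and
      it produces the source.\<close>
    have S0: "S n = (\<Sum>k\<in>?I. ?K n k ** X k) - ?K n (Suc n) ** X (Suc n)"
      by (cases "n = 0") (simp_all add: S_def)
    have "mat_adj (prevA A n) ** S n + B n ** S (Suc n) + A n ** S (Suc (Suc n))
       = (\<Sum>k\<in>?I. (mat_adj (prevA A n) ** ?K n k + B n ** ?K (Suc n) k + A n ** ?K (Suc (Suc n)) k) ** X k)
         - (mat_adj (prevA A n) ** ?K n (Suc n)) ** X (Suc n)"
      unfolding S0 S1 unfolding S_def by (simp only: matrix_distribs sum.distrib) simp
    also have "\<dots> = (\<Sum>k\<in>?I. mat (of_real l) ** ?K (Suc n) k ** X k) - X (Suc n)"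
      using emgev_green_kernel[of l] unfolding prevA_green_kernel by (simp add: emgev_def)
    finally show ?thesis by (simp add: S1 matrix_distribs)
  qed
  have "emgev A B (of_real l) (\<lambda>n. X n + ?c ** S n)"
    unfolding emgev_def
  proof
    fix n
    have "mat_adj (prevA A n) ** (X n + ?c ** S n) + B n ** (X (Suc n) + ?c ** S (Suc n))
        + A n ** (X (Suc (Suc n)) + ?c ** S (Suc (Suc n)))
      = (mat_adj (prevA A n) ** X n + B n ** X (Suc n) + A n ** X (Suc (Suc n)))
        + ?c ** (mat_adj (prevA A n) ** S n + B n ** S (Suc n) + A n ** S (Suc (Suc n)))"
      by (simp only: matrix_add_distribs mat_mul_left_commute) (simp add: algebra_simps)
    also have "\<dots> = mat z ** X (Suc n) + ?c ** (mat (of_real l) ** S (Suc n) - X (Suc n))"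
      using X by (simp add: emgev_def S)
    also have "\<dots> = mat (of_real l) ** (X (Suc n) + ?c ** S (Suc n))"
      by (simp add: matrix_add_distribs mat_mul_left_commute[of ?c]
          mat_mul_left_commute[of "mat z" "of_real l"] mat_diff_mul)
    finally show "mat_adj (prevA A n) ** (X n + ?c ** S n) + B n ** (X (Suc n) + ?c ** S (Suc n))
        + A n ** (X (Suc (Suc n)) + ?c ** S (Suc (Suc n)))
      = mat (of_real l) ** (X (Suc n) + ?c ** S (Suc n))" .
  qed
  then have "Y = (\<lambda>n. X n + ?c ** S n)"
    by (rule emgev_unique[OF Y]) (simp_all add: S_def init)
  then show ?thesis by (simp add: S_def)
qed

lemma emgev_perturbation_pointwise:
  assumes X: "emgev A B z X" and Y: "emgev A B (of_real l) Y"
    and init: "X 0 = Y 0" "X (Suc 0) = Y (Suc 0)"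
  defines "P \<equiv> emgevP A B (of_real l)" and "Q \<equiv> emgevQ A B (of_real l)"
  shows "op_norm (Y (Suc n)) \<le> op_norm (X (Suc n)) + cmod (z - of_real l) *
    (op_norm (P (Suc n)) * (\<Sum>k<n. op_norm (Q (Suc k)) * op_norm (X (Suc k)))
     + op_norm (Q (Suc n)) * (\<Sum>k<n. op_norm (P (Suc k)) * op_norm (X (Suc k))))"
proof -
  let ?K = "green_kernel l"
  have K: "op_norm (?K m k ** X k) \<le>
      op_norm (P m) * (op_norm (Q k) * op_norm (X k)) + op_norm (Q m) * (op_norm (P k) * op_norm (X k))" for m k
  proof -
    have "op_norm (?K m k) \<le> op_norm (P m ** mat_adj (Q k)) + op_norm (- (Q m ** mat_adj (P k)))"
      unfolding green_kernel_def P_def Q_def diff_conv_add_uminus by (rule op_norm_triangle)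
    also have "\<dots> \<le> op_norm (P m) * op_norm (Q k) + op_norm (Q m) * op_norm (P k)"
      by (intro add_mono) (metis op_norm_mult op_norm_adj op_norm_minus)+
    finally have "op_norm (?K m k) * op_norm (X k) \<le> \<dots> * op_norm (X k)"
      by (rule mult_right_mono) simp
    then show ?thesis
      using op_norm_mult[of "?K m k" "X k"] by (simp add: algebra_simps)
  qed
  have "op_norm (\<Sum>k\<in>{1..<Suc n}. ?K (Suc n) k ** X k) \<le> (\<Sum>k\<in>{1..<Suc n}. op_norm (?K (Suc n) k ** X k))"
    by (rule op_norm_sum)
  also have "\<dots> = (\<Sum>k<n. op_norm (?K (Suc n) (Suc k) ** X (Suc k)))"
    unfolding One_nat_def lessThan_atLeast0 by (rule sum.shift_bounds_Suc_ivl)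
  also have "\<dots> \<le> (\<Sum>k<n. op_norm (P (Suc n)) * (op_norm (Q (Suc k)) * op_norm (X (Suc k)))
      + op_norm (Q (Suc n)) * (op_norm (P (Suc k)) * op_norm (X (Suc k))))"
    by (intro sum_mono K)
  also have "\<dots> = op_norm (P (Suc n)) * (\<Sum>k<n. op_norm (Q (Suc k)) * op_norm (X (Suc k)))
     + op_norm (Q (Suc n)) * (\<Sum>k<n. op_norm (P (Suc k)) * op_norm (X (Suc k)))"
    by (simp add: sum.distrib sum_distrib_left)
  finally have S: "op_norm (\<Sum>k\<in>{1..<Suc n}. ?K (Suc n) k ** X k) \<le> \<dots>" .
  have "op_norm (Y (Suc n)) \<le> op_norm (X (Suc n))
      + op_norm (mat (z - of_real l) ** (\<Sum>k\<in>{1..<Suc n}. ?K (Suc n) k ** X k))"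
    by (subst emgev_variation_of_constants[OF X Y init]) (rule op_norm_triangle)
  also have "\<dots> \<le> op_norm (X (Suc n))
      + cmod (z - of_real l) * op_norm (\<Sum>k\<in>{1..<Suc n}. ?K (Suc n) k ** X k)"
    by (intro add_left_mono order_trans[OF op_norm_mult]) simp
  also have "\<dots> \<le> op_norm (X (Suc n)) + cmod (z - of_real l) *
    (op_norm (P (Suc n)) * (\<Sum>k<n. op_norm (Q (Suc k)) * op_norm (X (Suc k)))
     + op_norm (Q (Suc n)) * (\<Sum>k<n. op_norm (P (Suc k)) * op_norm (X (Suc k))))"
    by (intro add_left_mono mult_left_mono S) simp
  finally show ?thesis .
qed

end

section \<open>The matrix Weyl function\<close>

lemma ell2_op_norm:
  assumes "summable (\<lambda>n. (op_norm (X n))\<^sup>2)"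
  shows "(\<lambda>n. X n *v v) \<in> ell2"
proof -
  have "(norm (X n *v v))\<^sup>2 \<le> (norm v)\<^sup>2 * (op_norm (X n))\<^sup>2" for n
    using power_mono[OF norm_le_op_norm[of "X n" v], of 2] by (simp add: power_mult_distrib mult.commute)
  then show ?thesis
    unfolding ell2_def
    by (auto intro!: summable_comparison_test'[OF summable_mult[OF assms, of "(norm v)\<^sup>2"], of 0])
qed

text \<open>There are finitely many columns, and their square sums dominate the operator
  norms.\<close>

lemma summable_op_norm_sq:
  fixes X :: "nat \<Rightarrow> complex^'d^'d"
  assumes "\<And>v. (\<lambda>n. X n *v v) \<in> ell2"
  shows "summable (\<lambda>n. (op_norm (X n))\<^sup>2)"
proof -
  have "summable (\<lambda>n. \<Sum>i\<in>UNIV. (norm (X n *v axis i 1))\<^sup>2)"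
    using assms by (intro summable_sum) (simp add: ell2_def)
  then show ?thesis
    by (rule summable_comparison_test'[of _ 0]) (simp add: op_norm_sq_le_columns)
qed

locale self_adjoint_jacobi = block_jacobi A B for A B :: "nat \<Rightarrow> complex^'d^'d" +
  assumes self_adjoint: "self_adjoint_op (jacobi_op A B)"
begin

section \<open>Symmetry of the operator and boundary terms of solutions\<close>

lemma jacobi_symmetric:
  assumes "u \<in> jacobi_dom A B" "v \<in> jacobi_dom A B"
  shows "ell2_inner (jacobi_expr A B u) v = ell2_inner u (jacobi_expr A B v)"
proof -
  have "(v, jacobi_expr A B v) \<in> graph_adjoint (jacobi_op A B)"
    using self_adjoint assms(2) by (auto simp: self_adjoint_op_def jacobi_op_def)
  then show ?thesis using assms(1) unfolding graph_adjoint_def jacobi_op_def by blast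
qed

text \<open>The premise only constrains the support of \<open>u\<close>, so that truncations of solutions are covered.\<close>

lemma dissipation_identity:
  assumes dom: "u \<in> jacobi_dom A B"
    and eq: "\<And>n. u n \<noteq> 0 \<Longrightarrow> jacobi_expr A B u n = z *s u n + (if n = 0 then g else 0)"
  shows "Im z * (\<Sum>n. (norm (u n))\<^sup>2) = Im (cdot (u 0) g)"
proof -
  let ?J = "jacobi_expr A B u" and ?S = "\<Sum>n. (norm (u n))\<^sup>2"
  have S: "(\<lambda>n. complex_of_real ((norm (u n))\<^sup>2)) sums of_real ?S"
    using dom by (intro sums_of_real summable_sums) (simp add: jacobi_dom_def ell2_def)
  have "cdot (?J n) (u n) = z * of_real ((norm (u n))\<^sup>2) + (if n = 0 then cdot g (u 0) else 0)" for n
    using eq[of n] by (cases "u n = 0") (auto simp: cdot_simps cdot_self)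
  then have sums: "(\<lambda>n. cdot (?J n) (u n)) sums (z * of_real ?S + cdot g (u 0))"
    using sums_add[OF sums_mult[OF S, of z] sums_single[of 0 "\<lambda>_. cdot g (u 0)"]] by (simp add: eq_commute[of 0])
  then have "(\<lambda>n. cdot (u n) (?J n)) sums cnj (z * of_real ?S + cdot g (u 0))"
    using sums_cnj[THEN iffD2, OF sums] by (simp flip: cdot_commute)
  then have "z * of_real ?S + cdot g (u 0) = cnj (z * of_real ?S + cdot g (u 0))"
    using jacobi_symmetric[OF dom dom] sums by (simp add: ell2_inner_def sums_iff)
  then have "Im (z * of_real ?S + cdot g (u 0)) = 0" by (simp add: complex_eq_iff)
  then show ?thesis by (subst cdot_commute) simp
qed

text \<open>The convention \<open>A_{-1} = -I\<close> turns the entry of index -1, which the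
  operator does not see, into a source at 0. Agreement of \<open>u\<close> with the solution up to
  \<open>Suc n\<close> is enough, so the lemma also covers truncations.\<close>

lemma jacobi_expr_emgev:
  assumes "emgev A B z U" "\<And>k. k \<le> Suc n \<Longrightarrow> u k = U (Suc k) *v v"
  shows "jacobi_expr A B u n = z *s (U (Suc n) *v v) + (if n = 0 then U 0 *v v else 0)"
proof -
  have "(mat_adj (prevA A n) ** U n + B n ** U (Suc n) + A n ** U (Suc (Suc n))) *v v
      = (mat z ** U (Suc n)) *v v"
    using assms(1) by (simp add: emgev_def)
  then have *: "mat_adj (prevA A n) *v (U n *v v) + B n *v (U (Suc n) *v v) + A n *v (U (Suc (Suc n)) *v v)
      = z *s (U (Suc n) *v v)"
    by (simp add: matrix_vector_mult_add_rdistrib mat_mul_vec flip: matrix_vector_mul_assoc)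
  show ?thesis
  proof (cases n)
    case 0
    have "mat_adj (prevA A 0) *v w = - w" for w
      by (simp add: prevA_def mat_adj_simps matrix_vector_mult_minus_left)
    then show ?thesis using * assms(2)[of 0] assms(2)[of 1] 0 by (simp add: algebra_simps)
  next
    case (Suc m)
    then show ?thesis
      using * assms(2)[of m] assms(2)[of "Suc m"] assms(2)[of "Suc (Suc m)"] by (simp add: prevA_def)
  qed
qed

lemma jacobi_dom_emgev:
  assumes U: "emgev A B z U" and ell2: "(\<lambda>n. U (Suc n) *v v) \<in> ell2"
  shows "(\<lambda>n. U (Suc n) *v v) \<in> jacobi_dom A B"
proof -
  let ?u = "\<lambda>n. U (Suc n) *v v"
  have "summable (\<lambda>n. (cmod z)\<^sup>2 * (norm (?u n))\<^sup>2)"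
    using ell2 by (intro summable_mult) (simp add: ell2_def)
  then have "summable (\<lambda>n. (norm (jacobi_expr A B ?u n))\<^sup>2)"
    by (rule summable_comparison_test'[of _ 1])
       (simp add: jacobi_expr_emgev[OF U] norm_vector_smult power_mult_distrib)
  then show ?thesis using ell2 by (simp add: jacobi_dom_def ell2_def)
qed

lemma emgev_ell2_identity:
  assumes U: "emgev A B z U" and ell2: "(\<lambda>n. U (Suc n) *v v) \<in> ell2"
  shows "Im z * (\<Sum>n. (norm (U (Suc n) *v v))\<^sup>2) = Im (cdot (U (Suc 0) *v v) (U 0 *v v))"
  using dissipation_identity[OF jacobi_dom_emgev[OF U ell2]] jacobi_expr_emgev[OF U] by metis

text \<open>If the entry of index \<open>N + 1\<close> vanishes, cutting the solution off after
  \<open>N\<close> changes nothing in the equations up to \<open>N\<close>, and the finitely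
  supported result lies in the domain.\<close>

lemma emgev_truncated_identity:
  assumes U: "emgev A B z U" and bc: "U (Suc (Suc N)) *v v = 0"
  shows "Im z * (\<Sum>n\<le>N. (norm (U (Suc n) *v v))\<^sup>2) = Im (cdot (U (Suc 0) *v v) (U 0 *v v))"
proof -
  define u where "u n = (if n \<le> N then U (Suc n) *v v else 0)" for n
  have u: "u k = U (Suc k) *v v" if "k \<le> Suc N" for k
    using that bc by (auto simp: u_def not_le le_Suc_eq)
  have J: "jacobi_expr A B u n = z *s u n + (if n = 0 then U 0 *v v else 0)" if "u n \<noteq> 0" for n
  proof -
    have "n \<le> N" using that by (auto simp: u_def split: if_splits)
    then show ?thesis using jacobi_expr_emgev[OF U, of n u v] u by auto
  qed
  \<comment> \<open>The image may be nonzero at \<open>N + 1\<close>, where it still sees the entry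
    \<open>N\<close>. Since \<open>u\<close> is zero there, the quadratic form does not
    notice.\<close>
  have supp: "u n = 0" "jacobi_expr A B u n = 0" if "n > Suc N" for n
    using that by (cases n; simp add: u_def)+
  have "summable (\<lambda>n. (norm (w n))\<^sup>2)" if "\<And>n. n > Suc N \<Longrightarrow> w n = 0" for w :: "nat \<Rightarrow> complex^'d"
    by (rule summable_finite[of "{..Suc N}"]) (simp_all add: that)
  then have "u \<in> jacobi_dom A B"
    using supp by (simp add: jacobi_dom_def ell2_def)
  then have "Im z * (\<Sum>n. (norm (u n))\<^sup>2) = Im (cdot (u 0) (U 0 *v v))"
    using J by (rule dissipation_identity)
  moreover have "(\<Sum>n. (norm (u n))\<^sup>2) = (\<Sum>n\<le>N. (norm (U (Suc n) *v v))\<^sup>2)"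
    by (subst suminf_finite[of "{..N}"]) (auto simp: u_def)
  ultimately show ?thesis by (simp add: u_def)
qed

section \<open>Finite sections, existence and uniqueness of the Weyl matrix\<close>

text \<open>A kernel vector \<open>v\<close> would make \<open>P v\<close> an eigenvector of a
  finite section at a non-real energy: its boundary term vanishes because the entry -1 of
  \<open>P\<close> is zero, so all entries up to \<open>N\<close> vanish, among them the entry 0,
  which is \<open>v\<close>.\<close>

lemma emgevP_invertible:
  assumes "Im z > 0"
  shows "det (emgevP A B z (Suc (Suc N))) \<noteq> 0"
proof -
  let ?P = "emgevP A B z"
  have "v = 0" if "?P (Suc (Suc N)) *v v = 0" for v
  proof -
    have "(\<Sum>n\<le>N. (norm (?P (Suc n) *v v))\<^sup>2) = 0"
      using emgev_truncated_identity[OF emgev_P that] assms by (simp add: cdot_simps)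
    then have "\<forall>n\<in>{..N}. (norm (?P (Suc n) *v v))\<^sup>2 = 0"
      by (subst (asm) sum_nonneg_eq_0_iff) auto
    from bspec[OF this, of 0] show "v = 0" by simp
  qed
  then show ?thesis
    by (meson invertible_det_nz invertible_left_inverse matrix_left_invertible_ker)
qed

text \<open>Chosen such that \<open>P W + Q\<close> vanishes right after the index \<open>N\<close>: the Weyl matrix of the finite section.\<close>

definition weyl_approx :: "complex \<Rightarrow> nat \<Rightarrow> complex^'d^'d" where
  "weyl_approx z N = - (matrix_inv (emgevP A B z (Suc (Suc N))) ** emgevQ A B z (Suc (Suc N)))"

lemma emgev_PWQ: "emgev A B z (\<lambda>n. emgevP A B z n ** W + emgevQ A B z n)"
  using emgev_lincomb[OF emgev_P emgev_Q, of z W "mat 1"] by simp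

text \<open>Uniformity in \<open>N\<close> is what matters. The entries -1 and 0 of
  \<open>P W + Q\<close> are \<open>I\<close> and \<open>W\<close>, so the truncated identity bounds
  \<open>Im z\<close> times the whole sum by \<open>|W v| |v|\<close>. The first summand is
  \<open>|W v|^2\<close>, and one factor cancels.\<close>

lemma weyl_approx_bounds:
  fixes v :: "complex^'d" and N :: nat
  assumes z: "Im z > 0"
  defines "W \<equiv> weyl_approx z N"
  shows "norm (W *v v) \<le> norm v / Im z" (is ?A)
    and "M \<le> N \<Longrightarrow> (\<Sum>n\<le>M. (norm ((emgevP A B z (Suc n) ** W + emgevQ A B z (Suc n)) *v v))\<^sup>2)
      \<le> (norm v / Im z)\<^sup>2" (is "_ \<Longrightarrow> ?B")
proof -
  let ?U = "\<lambda>n. emgevP A B z n ** W + emgevQ A B z n"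
  let ?S = "\<lambda>N. \<Sum>n\<le>N. (norm (?U (Suc n) *v v))\<^sup>2"
  have "?U (Suc (Suc N)) *v v = 0"
    by (simp add: W_def weyl_approx_def matrix_add_distribs matrix_mul_assoc matrix_inv emgevP_invertible[OF z])
  from emgev_truncated_identity[OF emgev_PWQ this]
  have "Im z * ?S N = Im (cdot (W *v v) v)" by simp
  also have "\<dots> \<le> norm (W *v v) * norm v"
    using abs_Im_le_cmod[of "cdot (W *v v) v"] cdot_Cauchy_Schwarz[of "W *v v" v] by linarith
  finally have S: "Im z * ?S N \<le> norm (W *v v) * norm v" .
  have "norm (?U (Suc 0) *v v) ^ 2 \<le> ?S N"
    by (rule member_le_sum[where f="\<lambda>n. (norm (?U (Suc n) *v v))\<^sup>2"]) auto
  then have "Im z * (norm (W *v v))\<^sup>2 \<le> Im z * ?S N" using z by simp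
  with S have "(Im z * norm (W *v v)) * norm (W *v v) \<le> norm v * norm (W *v v)"
    by (simp add: power2_eq_square mult_ac)
  then have "Im z * norm (W *v v) \<le> norm v" using z
    by (cases "W *v v = 0") (simp_all add: mult_le_cancel_right)
  then show A: ?A using z by (simp add: field_simps)
  assume "M \<le> N"
  then have "?S M \<le> ?S N" by (intro sum_mono2) auto
  also have "Im z * ?S N \<le> norm v / Im z * norm v"
    using S mult_right_mono[OF A, of "norm v"] by simp
  then have "?S N \<le> (norm v / Im z)\<^sup>2" using z by (simp add: power2_eq_square field_simps)
  finally show ?B .
qed

text \<open>The finite-section matrices lie in a compact ball. Along a convergent subsequence each
  partial sum of fixed length is continuous in the matrix and inherits the bound once
  \<open>r j\<close> has passed that length; the length tends to infinity only afterwards.\<close>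

lemma weyl_exists:
  assumes z: "Im z > 0"
  obtains W where "summable (\<lambda>n. (op_norm (emgevP A B z n ** W + emgevQ A B z n))\<^sup>2)"
proof -
  let ?R = "(real CARD('d))\<^sup>2 * (1 / Im z)"
  have "op_norm (weyl_approx z N) \<le> 1 / Im z" for N
    by (rule op_norm_le) (use weyl_approx_bounds(1)[OF z] in simp)
  then have "norm (weyl_approx z N) \<le> ?R" for N
    by (intro order_trans[OF norm_le_card_op_norm] mult_left_mono) simp_all
  then have "\<forall>N. weyl_approx z N \<in> cball 0 ?R" by simp
  then obtain W r where r: "strict_mono r" and W: "(weyl_approx z \<circ> r) \<longlonglongrightarrow> W"
    using compact_cball[of "0 :: complex^'d^'d" ?R] unfolding compact_def by blast
  let ?U = "\<lambda>W n. emgevP A B z (Suc n) ** W + emgevQ A B z (Suc n)"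
  have U_vec: "?U W n *v v = emgevP A B z (Suc n) *v (W *v v) + emgevQ A B z (Suc n) *v v" for W n v
    by (simp add: matrix_vector_mult_add_rdistrib matrix_vector_mul_assoc)
  have "(\<lambda>n. ?U W n *v v) \<in> ell2" for v
  proof -
    have "(\<Sum>n<M. (norm (?U W n *v v))\<^sup>2) \<le> (norm v / Im z)\<^sup>2" for M
    proof (rule tendsto_upperbound)
      show "(\<lambda>j. \<Sum>n<M. (norm (?U (weyl_approx z (r j)) n *v v))\<^sup>2) \<longlonglongrightarrow> (\<Sum>n<M. (norm (?U W n *v v))\<^sup>2)"
        unfolding U_vec
        by (intro tendsto_sum tendsto_power tendsto_norm tendsto_add tendsto_const
            bounded_linear.tendsto[OF bounded_linear_matrix_vector_mult] tendsto_matrix_vector_mult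
            W[unfolded o_def])
      show "\<forall>\<^sub>F j in sequentially. (\<Sum>n<M. (norm (?U (weyl_approx z (r j)) n *v v))\<^sup>2) \<le> (norm v / Im z)\<^sup>2"
      proof (rule eventually_sequentiallyI)
        fix j assume "M \<le> j"
        then have "M \<le> r j" using seq_suble[OF r, of j] by linarith
        then show "(\<Sum>n<M. (norm (?U (weyl_approx z (r j)) n *v v))\<^sup>2) \<le> (norm v / Im z)\<^sup>2"
          by (intro order_trans[OF sum_mono2 weyl_approx_bounds(2)[OF z]]) auto
      qed
    qed simp
    then show ?thesis unfolding ell2_def
      by (auto intro!: summableI_nonneg_bounded[where x="(norm v / Im z)\<^sup>2"])
  qed
  then have "summable (\<lambda>n. (op_norm (?U W n))\<^sup>2)" by (rule summable_op_norm_sq)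
  then have "summable (\<lambda>n. (op_norm (emgevP A B z n ** W + emgevQ A B z n))\<^sup>2)"
    by (subst (asm) summable_Suc_iff)
  then show ?thesis by (rule that)
qed

text \<open>The boundary term vanishes with \<open>U 0\<close>, so a nonzero \<open>U\<close> would
  yield an eigenvector of the symmetric operator at a non-real energy.\<close>

lemma emgev_decaying_zero:
  assumes z: "Im z > 0" and U: "emgev A B z U" "U 0 = 0"
    and sum: "summable (\<lambda>n. (op_norm (U n))\<^sup>2)"
  shows "U (Suc 0) = 0"
proof -
  have "U (Suc 0) *v v = 0 *v v" for v
  proof -
    have ell2: "(\<lambda>n. U (Suc n) *v v) \<in> ell2"
      by (rule ell2_op_norm) (use sum in \<open>simp add: summable_Suc_iff[of "\<lambda>n. (op_norm (U n))\<^sup>2"]\<close>)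
    have "(\<Sum>n. (norm (U (Suc n) *v v))\<^sup>2) = 0"
      using emgev_ell2_identity[OF U(1) ell2] U(2) z by (simp add: cdot_simps)
    then have "\<forall>n. (norm (U (Suc n) *v v))\<^sup>2 = 0"
      using ell2 by (subst (asm) suminf_eq_zero_iff) (auto simp: ell2_def)
    then show ?thesis by simp
  qed
  then show ?thesis by (subst matrix_eq) blast
qed

text \<open>Two candidates differ by a solution \<open>P (W' - W)\<close> that is square-summable
  and has entry -1 equal to zero. With existence this gives the definite description in
  \<open>weyl\<close> its meaning.\<close>

lemma weyl_summable:
  assumes z: "Im z > 0"
  shows "summable (\<lambda>n. (op_norm (emgevP A B z n ** weyl A B z + emgevQ A B z n))\<^sup>2)"
proof -
  let ?U = "\<lambda>W n. emgevP A B z n ** W + emgevQ A B z n"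
  obtain W where W: "summable (\<lambda>n. (op_norm (?U W n))\<^sup>2)" using weyl_exists[OF z] .
  have "W' = W" if W': "summable (\<lambda>n. (op_norm (?U W' n))\<^sup>2)" for W'
  proof -
    let ?D = "\<lambda>n. emgevP A B z n ** (W' - W)"
    have D: "emgev A B z ?D"
      using emgev_lincomb[OF emgev_P emgev_P, of z "W' - W" 0] by simp
    have "(op_norm (?D n))\<^sup>2 \<le> 2 * ((op_norm (?U W' n))\<^sup>2 + (op_norm (?U W n))\<^sup>2)" for n
    proof -
      have "?D n = ?U W' n + (- ?U W n)" by (simp add: matrix_add_distribs)
      then have "op_norm (?D n) \<le> op_norm (?U W' n) + op_norm (?U W n)"
        by (metis op_norm_triangle op_norm_minus)
      then have "(op_norm (?D n))\<^sup>2 \<le> (op_norm (?U W' n) + op_norm (?U W n))\<^sup>2"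
        by (intro power_mono) simp_all
      also have "\<dots> \<le> 2 * ((op_norm (?U W' n))\<^sup>2 + (op_norm (?U W n))\<^sup>2)"
        using sum_squares_bound[of "op_norm (?U W' n)" "op_norm (?U W n)"] by (simp add: power2_sum)
      finally show ?thesis .
    qed
    then have "summable (\<lambda>n. (op_norm (?D n))\<^sup>2)"
      by (intro summable_comparison_test'[OF summable_mult[OF summable_add[OF W' W], of 2], of 0]) simp
    from emgev_decaying_zero[OF z D _ this] show ?thesis by simp
  qed
  with W show ?thesis unfolding weyl_def by (rule theI2) 
qed

lemma weyl_identity:
  fixes v :: "complex^'d"
  assumes z: "Im z > 0"
  defines "U \<equiv> \<lambda>n. emgevP A B z n ** weyl A B z + emgevQ A B z n"
  shows "summable (\<lambda>n. (norm (U (Suc n) *v v))\<^sup>2)"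
    and "Im z * (\<Sum>n. (norm (U (Suc n) *v v))\<^sup>2) = Im (cdot (weyl A B z *v v) v)"
proof -
  have "summable (\<lambda>n. (op_norm (U (Suc n)))\<^sup>2)"
    using weyl_summable[OF z] summable_Suc_iff[of "\<lambda>n. (op_norm (U n))\<^sup>2"] by (simp add: U_def)
  then have ell2: "(\<lambda>n. U (Suc n) *v v) \<in> ell2" by (rule ell2_op_norm)
  then show "summable (\<lambda>n. (norm (U (Suc n) *v v))\<^sup>2)" by (simp add: ell2_def)
  show "Im z * (\<Sum>n. (norm (U (Suc n) *v v))\<^sup>2) = Im (cdot (weyl A B z *v v) v)"
    using emgev_ell2_identity[OF emgev_PWQ ell2[unfolded U_def]] by (simp add: U_def)
qed

text \<open>For real spectral parameter \<open>P v\<close> and \<open>Q v\<close> cannot both be square-summable: they would both lie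
  in the domain of \<open>J\<close>, where the boundary term at \<open>0\<close> would contradict symmetry.\<close>

lemma emgevP_or_emgevQ_not_summable:
  "\<not> (summable (\<lambda>n. (op_norm (emgevP A B (of_real l) (Suc n)))\<^sup>2) \<and>
      summable (\<lambda>n. (op_norm (emgevQ A B (of_real l) (Suc n)))\<^sup>2))"
proof
  let ?P = "emgevP A B (of_real l)" and ?Q = "emgevQ A B (of_real l)"
  assume *: "summable (\<lambda>n. (op_norm (?P (Suc n)))\<^sup>2) \<and> summable (\<lambda>n. (op_norm (?Q (Suc n)))\<^sup>2)"
  define v :: "complex^'d" where "v = axis undefined 1"
  define u w where "u n = ?P (Suc n) *v v" and "w n = ?Q (Suc n) *v v" for n
  have ell2: "u \<in> ell2" "w \<in> ell2"
    using * unfolding u_def w_def by (auto intro: ell2_op_norm)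
  then have dom: "u \<in> jacobi_dom A B" "w \<in> jacobi_dom A B"
    unfolding u_def w_def by (auto intro: jacobi_dom_emgev emgev_P emgev_Q)
  have J: "jacobi_expr A B u n = of_real l *s u n"
    "jacobi_expr A B w n = of_real l *s w n + (if n = 0 then v else 0)" for n
    using jacobi_expr_emgev[OF emgev_P, of n u "of_real l" v] jacobi_expr_emgev[OF emgev_Q, of n w "of_real l" v]
    by (simp_all add: u_def w_def)
  have "summable (\<lambda>n. cdot (u n) (w n))"
  proof (rule summable_comparison_test'[of "\<lambda>n. (norm (u n))\<^sup>2 + (norm (w n))\<^sup>2" 0])
    show "summable (\<lambda>n. (norm (u n))\<^sup>2 + (norm (w n))\<^sup>2)"
      using ell2 by (intro summable_add) (simp_all add: ell2_def)
    fix n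
    have "0 \<le> norm (u n) * norm (w n)" by simp
    then show "norm (cdot (u n) (w n)) \<le> (norm (u n))\<^sup>2 + (norm (w n))\<^sup>2"
      using cdot_Cauchy_Schwarz[of "u n" "w n"] sum_squares_bound[of "norm (u n)" "norm (w n)"] by linarith
  qed
  then obtain s where s: "(\<lambda>n. cdot (u n) (w n)) sums s" by blast
  have "(\<lambda>n. cdot (jacobi_expr A B u n) (w n)) sums (of_real l * s)"
    using sums_mult[OF s, of "of_real l"] by (simp add: J cdot_simps)
  moreover have "cdot (u n) (jacobi_expr A B w n)
      = of_real l * cdot (u n) (w n) + (if n = 0 then cdot (u 0) v else 0)" for n
    by (simp add: J cdot_simps)
  then have "(\<lambda>n. cdot (u n) (jacobi_expr A B w n)) sums (of_real l * s + cdot (u 0) v)"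
    using sums_add[OF sums_mult[OF s, of "of_real l"] sums_single[of 0 "\<lambda>_. cdot (u 0) v"]] by (simp add: eq_commute[of 0])
  ultimately have "of_real l * s = of_real l * s + cdot (u 0) v"
    using jacobi_symmetric[OF dom] by (simp add: ell2_inner_def sums_iff)
  then show False by (simp add: u_def cdot_self v_def norm_axis_1)
qed

end

section \<open>Truncated norms and the Jitomirskaya--Last function\<close>

declare mat_1_neq_0 [simp]

text \<open>The weight of the entry \<open>k\<close> in the truncated norm: 1 up to the floor of
  \<open>t\<close>, the fractional part at the next index, 0 beyond. As a clipped linear function it
  is monotone and continuous in \<open>t\<close>, and truncated norms become weighted Euclidean
  norms over one fixed index range.\<close>

definition cutoff :: "real \<Rightarrow> nat \<Rightarrow> real" where
  "cutoff t k = max 0 (min 1 (t - real k + 1))"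

lemma cutoff_nonneg [simp]: "0 \<le> cutoff t k"
  and cutoff_le_1 [simp]: "cutoff t k \<le> 1"
  and cutoff_mono: "s \<le> t \<Longrightarrow> cutoff s k \<le> cutoff t k"
  by (auto simp: cutoff_def)

lemma cutoff_eq:
  assumes "0 \<le> t"
  shows "k \<le> nat \<lfloor>t\<rfloor> \<Longrightarrow> cutoff t k = 1"
    and "cutoff t (Suc (nat \<lfloor>t\<rfloor>)) = frac t"
    and "k > Suc (nat \<lfloor>t\<rfloor>) \<Longrightarrow> cutoff t k = 0"
proof -
  define m where "m = real_of_int \<lfloor>t\<rfloor>"
  have fl: "real (nat \<lfloor>t\<rfloor>) = m" using assms by (simp add: m_def)
  have t: "m \<le> t" "t < m + 1" unfolding m_def by linarith+
  show "cutoff t k = 1" if "k \<le> nat \<lfloor>t\<rfloor>"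
  proof -
    have "real k \<le> real (nat \<lfloor>t\<rfloor>)" using that by simp
    then show ?thesis using t fl by (simp add: cutoff_def)
  qed
  show "cutoff t (Suc (nat \<lfloor>t\<rfloor>)) = frac t"
    using t fl by (simp add: cutoff_def frac_def m_def[symmetric])
  show "cutoff t k = 0" if "k > Suc (nat \<lfloor>t\<rfloor>)"
  proof -
    have "real (Suc (Suc (nat \<lfloor>t\<rfloor>))) \<le> real k" using that by (simp only: of_nat_le_iff Suc_le_eq)
    then show ?thesis using t fl by (simp add: cutoff_def)
  qed
qed

lemma cutoff_strict:
  assumes "0 \<le> s" "s < t"
  shows "cutoff s (Suc (nat \<lfloor>s\<rfloor>)) < cutoff t (Suc (nat \<lfloor>s\<rfloor>))"
proof -
  define m where "m = real_of_int \<lfloor>s\<rfloor>"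
  have fl: "real (nat \<lfloor>s\<rfloor>) = m" using assms by (simp add: m_def)
  have "m \<le> s" "s < m + 1" unfolding m_def by linarith+
  then show ?thesis using fl assms by (simp add: cutoff_def max_def min_def)
qed

lemma trunc_norm_sq:
  assumes t: "0 \<le> t" and N: "nat \<lfloor>t\<rfloor> < N"
  shows "(trunc_norm X t)\<^sup>2 = (\<Sum>k\<le>N. cutoff t k * (op_norm (X (Suc k)))\<^sup>2)"
proof -
  let ?m = "nat \<lfloor>t\<rfloor>"
  have "(\<Sum>k\<le>N. cutoff t k * (op_norm (X (Suc k)))\<^sup>2) = (\<Sum>k\<le>Suc ?m. cutoff t k * (op_norm (X (Suc k)))\<^sup>2)"
    using N cutoff_eq(3)[OF t] by (intro sum.mono_neutral_right) (auto simp: not_le)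
  also have "\<dots> = (\<Sum>k\<le>?m. (op_norm (X (Suc k)))\<^sup>2) + frac t * (op_norm (X (Suc (Suc ?m))))\<^sup>2"
    using cutoff_eq[OF t] by simp
  finally show ?thesis
    unfolding trunc_norm_def by (simp add: sum_nonneg)
qed

lemma trunc_norm_nonneg [simp]: "0 \<le> trunc_norm X t"
  unfolding trunc_norm_def by (intro real_sqrt_ge_zero add_nonneg_nonneg sum_nonneg mult_nonneg_nonneg) auto

lemma trunc_norm_L2_set:
  assumes "0 \<le> t" "nat \<lfloor>t\<rfloor> < N"
  shows "trunc_norm X t = L2_set (\<lambda>k. sqrt (cutoff t k) * op_norm (X (Suc k))) {..N}"
proof -
  have "trunc_norm X t = sqrt ((trunc_norm X t)\<^sup>2)" by simp
  then show ?thesis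
    unfolding L2_set_def trunc_norm_sq[OF assms] by (simp add: power_mult_distrib)
qed

lemma trunc_norm_mono:
  assumes "0 \<le> s" "s \<le> t"
  shows "trunc_norm X s \<le> trunc_norm X t"
proof (rule power2_le_imp_le)
  let ?N = "Suc (nat \<lfloor>t\<rfloor>)"
  have "nat \<lfloor>s\<rfloor> \<le> nat \<lfloor>t\<rfloor>" using assms by (intro nat_mono floor_mono)
  then have sq: "(trunc_norm X s)\<^sup>2 = (\<Sum>k\<le>?N. cutoff s k * (op_norm (X (Suc k)))\<^sup>2)"
    "(trunc_norm X t)\<^sup>2 = (\<Sum>k\<le>?N. cutoff t k * (op_norm (X (Suc k)))\<^sup>2)"
    using assms by (auto intro!: trunc_norm_sq simp del: sum.atMost_Suc)
  show "(trunc_norm X s)\<^sup>2 \<le> (trunc_norm X t)\<^sup>2"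
    unfolding sq by (intro sum_mono mult_right_mono cutoff_mono assms) simp
qed simp

text \<open>Just after \<open>s\<close> the weight that grows is the one at the index floor of
  \<open>s\<close> plus 1. The encoding shifts that entry by one more, hence the double
  \<open>Suc\<close>.\<close>

lemma trunc_norm_strict_mono:
  assumes "0 \<le> s" "s < t" "X (Suc (Suc (nat \<lfloor>s\<rfloor>))) \<noteq> 0"
  shows "trunc_norm X s < trunc_norm X t"
proof (rule power2_less_imp_less)
  let ?m = "nat \<lfloor>s\<rfloor>" and ?N = "Suc (nat \<lfloor>t\<rfloor>)"
  have m: "?m \<le> nat \<lfloor>t\<rfloor>" using assms by (intro nat_mono floor_mono) simp
  have "(\<Sum>k\<le>?N. cutoff s k * (op_norm (X (Suc k)))\<^sup>2) < (\<Sum>k\<le>?N. cutoff t k * (op_norm (X (Suc k)))\<^sup>2)"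
  proof (rule sum_strict_mono_ex1)
    show "\<forall>k\<in>{..?N}. cutoff s k * (op_norm (X (Suc k)))\<^sup>2 \<le> cutoff t k * (op_norm (X (Suc k)))\<^sup>2"
      using assms by (auto intro!: mult_right_mono cutoff_mono)
    have "cutoff s (Suc ?m) * (op_norm (X (Suc (Suc ?m))))\<^sup>2 < cutoff t (Suc ?m) * (op_norm (X (Suc (Suc ?m))))\<^sup>2"
      using assms by (intro mult_strict_right_mono cutoff_strict) simp_all
    then show "\<exists>k\<in>{..?N}. cutoff s k * (op_norm (X (Suc k)))\<^sup>2 < cutoff t k * (op_norm (X (Suc k)))\<^sup>2"
      using m by (intro bexI[of _ "Suc ?m"]) auto
  qed simp
  then show "(trunc_norm X s)\<^sup>2 < (trunc_norm X t)\<^sup>2"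
    using assms m trunc_norm_sq[of s ?N X] trunc_norm_sq[of t ?N X] by (simp del: sum.atMost_Suc)
qed simp

lemma trunc_norm_of_nat: "(trunc_norm X (real m))\<^sup>2 = (\<Sum>k\<le>m. (op_norm (X (Suc k)))\<^sup>2)"
  unfolding trunc_norm_def by (simp add: sum_nonneg)

lemma continuous_on_trunc_norm: "continuous_on {0..T} (trunc_norm X)"
proof -
  have "continuous_on {0..T} (\<lambda>t. L2_set (\<lambda>k. sqrt (cutoff t k) * op_norm (X (Suc k))) {..Suc (nat \<lfloor>T\<rfloor>)})"
    unfolding L2_set_def cutoff_def by (intro continuous_intros)
  moreover have "trunc_norm X t = L2_set (\<lambda>k. sqrt (cutoff t k) * op_norm (X (Suc k))) {..Suc (nat \<lfloor>T\<rfloor>)}"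
    if "t \<in> {0..T}" for t
  proof -
    have "nat \<lfloor>t\<rfloor> \<le> nat \<lfloor>T\<rfloor>" using that by (intro nat_mono floor_mono) simp
    then show ?thesis using that by (intro trunc_norm_L2_set) auto
  qed
  ultimately show ?thesis by (subst continuous_on_cong[OF refl]) auto
qed

lemma trunc_norm_le_suminf:
  assumes t: "0 \<le> t" and sum: "summable a" and bound: "\<And>k. (op_norm (X (Suc k)))\<^sup>2 \<le> a k"
  shows "(trunc_norm X t)\<^sup>2 \<le> suminf a"
proof -
  have a: "0 \<le> a k" for k using bound[of k] by (rule order_trans[rotated]) simp
  have "(trunc_norm X t)\<^sup>2 \<le> (\<Sum>k\<le>Suc (nat \<lfloor>t\<rfloor>). a k)"
    unfolding trunc_norm_sq[OF t lessI]
  proof (rule sum_mono)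
    fix k
    have "cutoff t k * (op_norm (X (Suc k)))\<^sup>2 \<le> 1 * (op_norm (X (Suc k)))\<^sup>2"
      by (intro mult_right_mono) simp_all
    then show "cutoff t k * (op_norm (X (Suc k)))\<^sup>2 \<le> a k" using bound[of k] by simp
  qed
  also have "\<dots> \<le> suminf a" by (rule sum_le_suminf[OF sum]) (auto simp: a)
  finally show ?thesis .
qed

section \<open>Truncated norms of solutions\<close>

context block_jacobi
begin

text \<open>From \<open>t = 1\<close> on the entries 0 and 1 both count in full. If both vanish, the
  recurrence at 0 with \<open>A_{-1} = -I\<close> also kills the entry -1, which the norm does not
  see.\<close>

lemma emgev_trunc_norm_pos:
  assumes U: "emgev A B z U" and nz: "U 0 \<noteq> 0 \<or> U (Suc 0) \<noteq> 0" and t: "1 \<le> t"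
  shows "0 < trunc_norm U t"
proof (rule ccontr)
  assume "\<not> 0 < trunc_norm U t"
  then have "trunc_norm U t = 0" using trunc_norm_nonneg[of U t] by simp
  then have "trunc_norm U (real 1) \<le> 0" using trunc_norm_mono[of 1 t U] t by simp
  then have "(trunc_norm U (real 1))\<^sup>2 = 0" using trunc_norm_nonneg[of U 1] by simp
  then have "(op_norm (U (Suc 0)))\<^sup>2 + (op_norm (U (Suc (Suc 0))))\<^sup>2 = 0"
    unfolding trunc_norm_of_nat by simp
  then have 0: "U (Suc 0) = 0" "U (Suc (Suc 0)) = 0" by (simp_all add: sum_power2_eq_zero_iff)
  then have "mat_adj (prevA A 0) ** U 0 = 0"
    using emgev_step[OF U, of 0] by simp
  then have "U 0 = 0" by (simp add: prevA_def mat_adj_simps matrix_add_distribs)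
  with nz 0 show False by simp
qed

text \<open>The sums in the pointwise bound only involve indices below \<open>n\<close>, all of which have cutoff weight 1;
  this is why the fractional part in the truncated norm does no harm.\<close>

lemma emgev_perturbation:
  assumes X: "emgev A B z X" and Y: "emgev A B (of_real l) Y"
    and init: "X 0 = Y 0" "X (Suc 0) = Y (Suc 0)" and t: "0 \<le> t"
  defines "p \<equiv> trunc_norm (emgevP A B (of_real l)) t" and "q \<equiv> trunc_norm (emgevQ A B (of_real l)) t"
  shows "trunc_norm Y t \<le> (1 + cmod (z - of_real l) * (2 * p * q)) * trunc_norm X t"
proof -
  let ?P = "emgevP A B (of_real l)" and ?Q = "emgevQ A B (of_real l)" and ?c = "cmod (z - of_real l)"
  let ?N = "Suc (nat \<lfloor>t\<rfloor>)" and ?x = "trunc_norm X t"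
  let ?w = "\<lambda>Z k. sqrt (cutoff t k) * op_norm (Z (Suc k))"
  have L2: "trunc_norm Z t = L2_set (?w Z) {..?N}" for Z
    by (rule trunc_norm_L2_set[OF t]) simp
  have below: "(\<Sum>k<n. op_norm (Z (Suc k)) * op_norm (X (Suc k))) \<le> trunc_norm Z t * ?x" if "n \<le> ?N" for n Z
  proof -
    have "(\<Sum>k<n. op_norm (Z (Suc k)) * op_norm (X (Suc k))) = (\<Sum>k<n. \<bar>?w Z k\<bar> * \<bar>?w X k\<bar>)"
      using that cutoff_eq(1)[OF t] by (intro sum.cong) auto
    also have "\<dots> \<le> (\<Sum>k\<le>?N. \<bar>?w Z k\<bar> * \<bar>?w X k\<bar>)" using that by (intro sum_mono2) auto
    also have "\<dots> \<le> trunc_norm Z t * ?x" unfolding L2 by (rule L2_set_mult_ineq)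
    finally show ?thesis .
  qed
  have "op_norm (Y (Suc n)) \<le> op_norm (X (Suc n)) + ?c * (op_norm (?P (Suc n)) * (q * ?x) + op_norm (?Q (Suc n)) * (p * ?x))"
    if "n \<le> ?N" for n
    unfolding p_def q_def
    by (rule order_trans[OF emgev_perturbation_pointwise[OF X Y init]])
       (intro add_left_mono mult_left_mono add_mono below that, auto)
  then have "sqrt (cutoff t n) * op_norm (Y (Suc n)) \<le> sqrt (cutoff t n) *
      (op_norm (X (Suc n)) + ?c * (op_norm (?P (Suc n)) * (q * ?x) + op_norm (?Q (Suc n)) * (p * ?x)))"
    if "n \<le> ?N" for n
    using that by (intro mult_left_mono) auto
  then have "L2_set (?w Y) {..?N} \<le> L2_set (\<lambda>n. ?w X n + (?c * (q * ?x) * ?w ?P n + ?c * (p * ?x) * ?w ?Q n)) {..?N}"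
    by (intro L2_set_mono) (simp_all add: algebra_simps)
  also have "\<dots> \<le> L2_set (?w X) {..?N} + L2_set (\<lambda>n. ?c * (q * ?x) * ?w ?P n + ?c * (p * ?x) * ?w ?Q n) {..?N}"
    by (rule L2_set_triangle_ineq)
  also have "\<dots> \<le> L2_set (?w X) {..?N} + (L2_set (\<lambda>n. ?c * (q * ?x) * ?w ?P n) {..?N} + L2_set (\<lambda>n. ?c * (p * ?x) * ?w ?Q n) {..?N})"
    by (intro add_left_mono L2_set_triangle_ineq)
  also have "\<dots> = ?x + (?c * (q * ?x) * p + ?c * (p * ?x) * q)"
    unfolding p_def q_def L2[symmetric] by (simp add: L2_set_right_distrib[symmetric] L2[symmetric])
  finally show ?thesis unfolding L2[of Y, symmetric] by (simp add: algebra_simps)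
qed

end

section \<open>Well-definedness of the Jitomirskaya-Last function\<close>

context self_adjoint_jacobi
begin

text \<open>Each factor stays above its positive value at 1, so a bounded product would bound both
  factors and make \<open>P\<close> and \<open>Q\<close> both square-summable, which
  self-adjointness excludes.\<close>

lemma jl_product_unbounded:
  "\<exists>t\<ge>1. C \<le> trunc_norm (emgevP A B (of_real l)) t * trunc_norm (emgevQ A B (of_real l)) t"
proof (rule ccontr)
  let ?P = "emgevP A B (of_real l)" and ?Q = "emgevQ A B (of_real l)"
  let ?p = "trunc_norm ?P" and ?q = "trunc_norm ?Q"
  assume "\<not> ?thesis"
  then have C: "?p t * ?q t < C" if "t \<ge> 1" for t using that by (meson not_le)
  have pos: "0 < ?p 1" "0 < ?q 1"
    by (rule emgev_trunc_norm_pos[OF emgev_P], simp_all)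
       (rule emgev_trunc_norm_pos[OF emgev_Q], simp_all)
  have "?p t \<le> C / ?q 1" "?q t \<le> C / ?p 1" if "1 \<le> t" for t
  proof -
    have "?p t * ?q 1 \<le> ?p t * ?q t" "?p 1 * ?q t \<le> ?p t * ?q t"
      using that by (auto intro!: mult_left_mono mult_right_mono trunc_norm_mono)
    then show "?p t \<le> C / ?q 1" "?q t \<le> C / ?p 1"
      using C[OF that] pos by (simp_all add: field_simps)
  qed
  moreover have "summable (\<lambda>n. (op_norm (X (Suc n)))\<^sup>2)" if X: "\<And>t. 1 \<le> t \<Longrightarrow> trunc_norm X t \<le> c"
    for X :: "nat \<Rightarrow> complex^'d^'d" and c
  proof (rule summableI_nonneg_bounded)
    fix n
    have "(\<Sum>k<n. (op_norm (X (Suc k)))\<^sup>2) \<le> (\<Sum>k\<le>Suc n. (op_norm (X (Suc k)))\<^sup>2)"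
      by (intro sum_mono2) auto
    also have "\<dots> \<le> c\<^sup>2" using X[of "real (Suc n)"] by (simp flip: trunc_norm_of_nat add: power_mono)
    finally show "(\<Sum>k<n. (op_norm (X (Suc k)))\<^sup>2) \<le> c\<^sup>2" .
  qed simp
  ultimately show False using emgevP_or_emgevQ_not_summable[of l] by blast
qed

lemma jl_product_strict_mono:
  assumes "0 < s" "s < t"
  shows "trunc_norm (emgevP A B (of_real l)) s * trunc_norm (emgevQ A B (of_real l)) s
    < trunc_norm (emgevP A B (of_real l)) t * trunc_norm (emgevQ A B (of_real l)) t"
proof -
  let ?P = "emgevP A B (of_real l)" and ?Q = "emgevQ A B (of_real l)"
  let ?p = "trunc_norm ?P" and ?q = "trunc_norm ?Q" and ?m = "nat \<lfloor>s\<rfloor>"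
  have P: "0 < ?p s"
  proof -
    have "(?p (real 0))\<^sup>2 = 1" unfolding trunc_norm_of_nat by simp
    then have "0 < ?p (real 0)" using trunc_norm_nonneg[of ?P "real 0"] by (cases "?p (real 0) = 0") (simp_all add: less_le)
    also have "\<dots> \<le> ?p s" using assms by (intro trunc_norm_mono) auto
    finally show ?thesis .
  qed
  \<comment> \<open>The entry 0 of \<open>Q\<close> is zero, so the norm vanishes at 0. The
    recurrence gives \<open>A_0 Q_1 = I\<close>, so it is positive right after 0.\<close>
  have Q: "0 < ?q s"
  proof -
    have "?Q (Suc (Suc 0)) \<noteq> 0"
    proof
      assume "?Q (Suc (Suc 0)) = 0"
      then have "mat_adj (prevA A 0) = 0"
        using emgev_step[OF emgev_Q, of 0 "of_real l"] by simp
      then show False by (simp add: prevA_def mat_adj_simps)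
    qed
    then have "?q 0 < ?q s" using assms by (intro trunc_norm_strict_mono) auto
    then show ?thesis by (rule le_less_trans[OF trunc_norm_nonneg])
  qed
  have le: "?p s \<le> ?p t" "?q s \<le> ?q t" using assms by (auto intro: trunc_norm_mono)
  \<comment> \<open>If both vanished, so would the off-diagonal kernel entry, against the Wronskian
    identity. Hence at least one factor grows strictly at \<open>s\<close>.\<close>
  have "?P (Suc (Suc ?m)) \<noteq> 0 \<or> ?Q (Suc (Suc ?m)) \<noteq> 0"
  proof (rule ccontr)
    assume "\<not> ?thesis"
    then have "green_kernel l (Suc ?m) (Suc (Suc ?m)) = 0"
      by (simp add: green_kernel_def mat_adj_simps)
    then show False
      using prevA_green_kernel[of "Suc ?m" l] by simp
  qed
  then have "?p s < ?p t \<or> ?q s < ?q t"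
    using assms trunc_norm_strict_mono[of s t] by auto
  then show ?thesis
    using P Q le by (auto intro: mult_less_le_imp_less mult_le_less_imp_less)
qed

lemma jl_fun_eq:
  fixes l \<epsilon> :: real
  assumes "\<epsilon> > 0"
  defines "t \<equiv> jl_fun A B l \<epsilon>"
  shows "trunc_norm (emgevP A B (of_real l)) t * trunc_norm (emgevQ A B (of_real l)) t = 1 / (2 * \<epsilon>)"
proof -
  let ?f = "\<lambda>t. trunc_norm (emgevP A B (of_real l)) t * trunc_norm (emgevQ A B (of_real l)) t"
  let ?c = "1 / (2 * \<epsilon>)"
  obtain T where T: "1 \<le> T" "?c \<le> ?f T" using jl_product_unbounded by blast
  have f0: "?f 0 = 0"
    using trunc_norm_of_nat[of "emgevQ A B (of_real l)" 0] by simp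
  have "\<exists>t\<ge>0. t \<le> T \<and> ?f t = ?c"
    using T f0 assms(1) by (intro IVT' continuous_on_mult continuous_on_trunc_norm) auto
  then obtain t0 where t0: "0 \<le> t0" "?f t0 = ?c" by auto
  then have "t0 \<noteq> 0" using f0 assms(1) by auto
  with t0 have t0': "0 < t0 \<and> ?f t0 = ?c" by simp
  have "s = t0" if "0 < s \<and> ?f s = ?c" for s
    using that t0' jl_product_strict_mono[of s t0 l] jl_product_strict_mono[of t0 s l]
    by (cases s t0 rule: linorder_cases) auto
  with t0' have "0 < t \<and> ?f t = ?c"
    unfolding t_def jl_fun_def by (rule theI)
  then show ?thesis by simp
qed

lemma trunc_norm_at_jl_fun:
  assumes "\<epsilon> > 0" and X: "emgev A B (Complex l \<epsilon>) X" and Y: "emgev A B (of_real l) Y"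
    and init: "X 0 = Y 0" "X (Suc 0) = Y (Suc 0)" and t: "0 \<le> jl_fun A B l \<epsilon>"
  shows "(trunc_norm Y (jl_fun A B l \<epsilon>))\<^sup>2 \<le> 4 * (trunc_norm X (jl_fun A B l \<epsilon>))\<^sup>2"
proof -
  have "cmod (Complex l \<epsilon> - of_real l) = \<epsilon>"
    using assms(1) by (simp add: cmod_def)
  then have "trunc_norm Y (jl_fun A B l \<epsilon>) \<le> 2 * trunc_norm X (jl_fun A B l \<epsilon>)"
    using emgev_perturbation[OF X Y init t] jl_fun_eq[OF assms(1), of l] assms(1) by (simp add: mult.assoc)
  then show ?thesis
    using power_mono[of "trunc_norm Y (jl_fun A B l \<epsilon>)" "2 * trunc_norm X (jl_fun A B l \<epsilon>)" 2]
    by (simp add: power_mult_distrib)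
qed

end

section \<open>Barriers\<close>

text \<open>Compare a solution with itself; \<open>P\<close> has normalised initial data and, for
  \<open>t \<ge> 1\<close>, positive norm, so the quotient is truly 1.\<close>

lemma (in block_jacobi) barrier_ge_1:
  assumes "barrier A B G b" "l \<in> G" "1 \<le> t"
  shows "1 \<le> b l t"
proof -
  let ?P = "emgevP A B (of_real l)"
  have "(op_norm (?P 0))\<^sup>2 + (op_norm (?P (Suc 0)))\<^sup>2 = 1" by simp
  then have "(trunc_norm ?P t / trunc_norm ?P t)\<^sup>2 \<le> b l t"
    using assms emgev_P unfolding barrier_def by blast
  moreover have "0 < trunc_norm ?P t"
    by (rule emgev_trunc_norm_pos[OF emgev_P _ assms(3)]) simp
  ultimately show ?thesis by simp
qed

text \<open>After \<open>U\<close> is rescaled to unit initial data, the barrier bounds the squared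
  norms of \<open>P\<close> and \<open>Q\<close> separately. The product then follows from
  \<open>2 p q \<le> p^2 + q^2\<close>, with no further constant.\<close>

lemma (in block_jacobi) barrier_product:
  assumes b: "barrier A B G b" "l \<in> G" and U: "emgev A B (of_real l) U" and t: "1 \<le> t"
  shows "((op_norm (U 0))\<^sup>2 + (op_norm (U (Suc 0)))\<^sup>2) *
      (trunc_norm (emgevP A B (of_real l)) t * trunc_norm (emgevQ A B (of_real l)) t)
    \<le> b l t * (trunc_norm U t)\<^sup>2"
proof (cases "U 0 = 0 \<and> U (Suc 0) = 0")
  case False
  let ?P = "emgevP A B (of_real l)" and ?Q = "emgevQ A B (of_real l)"
  define r where "r = sqrt ((op_norm (U 0))\<^sup>2 + (op_norm (U (Suc 0)))\<^sup>2)"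
  have "0 < (op_norm (U 0))\<^sup>2 + (op_norm (U (Suc 0)))\<^sup>2"
    using False by (simp add: sum_power2_gt_zero_iff)
  then have r: "r > 0" "r\<^sup>2 = (op_norm (U 0))\<^sup>2 + (op_norm (U (Suc 0)))\<^sup>2"
    by (auto simp: r_def)
  \<comment> \<open>The zero summand only gives \<open>V\<close> the shape required by
    \<open>emgev_lincomb\<close>.\<close>
  define V where "V n = U n ** mat (of_real (1 / r)) + U n ** 0" for n
  have V: "emgev A B (of_real l) V" unfolding V_def by (rule emgev_lincomb[OF U U])
  have op_V: "op_norm (V n) = op_norm (U n) / r" for n
  proof (rule antisym)
    have *: "V n = U n ** mat (of_real (1 / r))" by (simp add: V_def)
    show "op_norm (V n) \<le> op_norm (U n) / r"
      using op_norm_mult[of "U n" "mat (of_real (1 / r))"] r by (simp add: * norm_divide)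
    have "U n = V n ** mat (of_real r)"
      using r by (simp add: * vec_eq_iff mul_mat_component)
    then show "op_norm (U n) / r \<le> op_norm (V n)"
      using op_norm_mult[of "V n" "mat (of_real r)"] r by (simp add: field_simps)
  qed
  have trunc_V: "(trunc_norm V t)\<^sup>2 = (trunc_norm U t)\<^sup>2 / r\<^sup>2"
    using t
    by (simp add: trunc_norm_sq[of t "Suc (nat \<lfloor>t\<rfloor>)"] op_V power_divide sum_divide_distrib add_divide_distrib del: sum.atMost_Suc)
  have init: "(op_norm (V 0))\<^sup>2 + (op_norm (V (Suc 0)))\<^sup>2 = 1"
    using r(1) by (simp add: op_V power_divide flip: add_divide_distrib r(2))
  have nz: "V 0 \<noteq> 0 \<or> V (Suc 0) \<noteq> 0" using init by auto
  have pos: "0 < (trunc_norm V t)\<^sup>2" using emgev_trunc_norm_pos[OF V nz t] by simp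
  have "(trunc_norm Z t)\<^sup>2 \<le> b l t * (trunc_norm V t)\<^sup>2" if "Z = ?P \<or> Z = ?Q" for Z
  proof -
    have "emgev A B (of_real l) Z" "(op_norm (Z 0))\<^sup>2 + (op_norm (Z (Suc 0)))\<^sup>2 = 1"
      using that emgev_P emgev_Q by auto
    then have "(trunc_norm Z t / trunc_norm V t)\<^sup>2 \<le> b l t"
      using b V init t unfolding barrier_def by blast
    then show ?thesis using pos by (simp add: power_divide pos_divide_le_eq)
  qed
  from this[of ?P] this[of ?Q] have "trunc_norm ?P t * trunc_norm ?Q t \<le> b l t * (trunc_norm V t)\<^sup>2"
    using sum_squares_bound[of "trunc_norm ?P t" "trunc_norm ?Q t"] by simp
  then have "r\<^sup>2 * (trunc_norm ?P t * trunc_norm ?Q t) \<le> r\<^sup>2 * (b l t * (trunc_norm V t)\<^sup>2)"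
    by (intro mult_left_mono) auto
  then show ?thesis using r(1) unfolding r(2)[symmetric] by (simp add: trunc_V)
next
  case True
  then show ?thesis using barrier_ge_1[OF assms(1,2,4)] by simp
qed

theorem theorem3p8:
  fixes A B :: "nat \<Rightarrow> complex^'d^'d"
    and G :: "real set"
    and b :: "real \<Rightarrow> real \<Rightarrow> real"
    and l \<epsilon> :: real
  assumes "\<And>n. det (A n) \<noteq> 0"
    and "\<And>n. mat_adj (B n) = B n"
    and "self_adjoint_op (jacobi_op A B)"
    and "G \<noteq> {}"
    and "barrier A B G b"
    and "l \<in> G"
    and "\<epsilon> > 0"
    and "jl_fun A B l \<epsilon> \<ge> 1"
  shows "let \<beta> = b l (jl_fun A B l \<epsilon>);
             d = real CARD('d);
             W = weyl A B (Complex l \<epsilon>);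
             s_minus = 4 * d * \<beta> - sqrt ((4 * d * \<beta>)\<^sup>2 - 1);
             s_plus = 4 * d * \<beta> + sqrt ((4 * d * \<beta>)\<^sup>2 - 1)
         in herm_le (mat (of_real (inverse (8 * \<beta>)))) (mat_Im W)
            \<and> s_minus \<le> op_norm W \<and> op_norm W \<le> s_plus"
proof -
  interpret self_adjoint_jacobi A B by unfold_locales (use assms in auto)
  define t where "t = jl_fun A B l \<epsilon>"
  define \<beta> where "\<beta> = b l t"
  define d where "d = real CARD('d)"
  define W where "W = weyl A B (Complex l \<epsilon>)"
  let ?z = "Complex l \<epsilon>" and ?l = "complex_of_real l"
  have t: "1 \<le> t" and \<epsilon>: "\<epsilon> > 0" using assms by (simp_all add: t_def)
  have \<beta>: "0 < \<beta>"
    using barrier_ge_1[OF assms(5,6) t] by (simp add: \<beta>_def)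
  define U where "U n = emgevP A B ?z n ** W + emgevQ A B ?z n" for n
  define Y where "Y n = emgevP A B ?l n ** W + emgevQ A B ?l n" for n
  have U: "emgev A B ?z (\<lambda>n. U n ** C)" and Y: "emgev A B ?l (\<lambda>n. Y n ** C)" for C
    using emgev_lincomb[OF emgev_PWQ emgev_PWQ, of ?z W C W 0] emgev_lincomb[OF emgev_PWQ emgev_PWQ, of ?l W C W 0]
    by (simp_all add: U_def Y_def)
  have init: "U 0 = mat 1" "Y 0 = mat 1" "U (Suc 0) = W" "Y (Suc 0) = W"
    by (simp_all add: U_def Y_def)
  have key: "(op_norm C)\<^sup>2 + (op_norm (W ** C))\<^sup>2 \<le> 8 * \<epsilon> * \<beta> * (trunc_norm (\<lambda>n. U n ** C) t)\<^sup>2" for C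
  proof -
    have "((op_norm C)\<^sup>2 + (op_norm (W ** C))\<^sup>2) * (1 / (2 * \<epsilon>)) \<le> \<beta> * (trunc_norm (\<lambda>n. Y n ** C) t)\<^sup>2"
      using barrier_product[OF assms(5,6) Y[of C] t] jl_fun_eq[OF \<epsilon>, of l]
      by (simp add: init t_def \<beta>_def)
    also have "\<dots> \<le> \<beta> * (4 * (trunc_norm (\<lambda>n. U n ** C) t)\<^sup>2)"
      unfolding t_def using trunc_norm_at_jl_fun[OF \<epsilon> U Y] t \<beta>
      by (intro mult_left_mono) (simp_all add: init t_def)
    finally show ?thesis using \<epsilon> by (simp add: field_simps)
  qed
  have weyl: "summable (\<lambda>n. (norm (U (Suc n) *v v))\<^sup>2)"
    "\<epsilon> * (\<Sum>n. (norm (U (Suc n) *v v))\<^sup>2) = Im (cdot (W *v v) v)" for v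
    using weyl_identity[of ?z v] \<epsilon> by (simp_all add: U_def W_def)
  have unit: "1 \<le> 8 * \<beta> * Im (cdot (W *v v) v)" if v: "norm v = 1" for v
  proof -
    \<comment> \<open>The projection has norm 1, and the term with \<open>W\<close> is simply
      dropped.\<close>
    have "1 \<le> (op_norm (outer_proj v))\<^sup>2 + (op_norm (W ** outer_proj v))\<^sup>2"
      using op_norm_mult_outer_proj[OF v, of "mat 1"] v by simp
    also have "\<dots> \<le> 8 * \<epsilon> * \<beta> * (trunc_norm (\<lambda>n. U n ** outer_proj v) t)\<^sup>2" by (rule key)
    also have "\<dots> \<le> 8 * \<epsilon> * \<beta> * (\<Sum>n. (norm (U (Suc n) *v v))\<^sup>2)"
      using \<epsilon> \<beta> t
      by (intro mult_left_mono trunc_norm_le_suminf weyl(1)) (simp_all add: op_norm_mult_outer_proj[OF v])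
    finally show ?thesis by (simp add: mult_ac flip: weyl(2))
  qed
  have "herm_le (mat (of_real (inverse (8 * \<beta>)))) (mat_Im W)"
    unfolding herm_le_def
  proof (intro conjI allI)
    fix v :: "complex^'d"
    show "Re (cdot (mat (of_real (inverse (8 * \<beta>))) *v v) v) \<le> Re (cdot (mat_Im W *v v) v)"
    proof (cases "v = 0")
      case False
      define e where "e = of_real (1 / norm v) *s v"
      have e: "norm e = 1" using False by (simp add: e_def norm_vector_smult norm_divide)
      have "Im (cdot (W *v e) e) = Im (cdot (W *v v) v) / (norm v)\<^sup>2"
        by (simp add: e_def vector_scalar_commute cdot_simps power2_eq_square Im_divide_of_real)
      then have "(norm v)\<^sup>2 \<le> 8 * \<beta> * Im (cdot (W *v v) v)"
        using mult_left_mono[OF unit[OF e], of "(norm v)\<^sup>2"] False by simp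
      then show ?thesis using \<beta>
        by (simp add: mat_mul_vec cdot_simps cdot_self cdot_mat_Im field_simps)
    qed (simp add: cdot_simps)
  qed (simp_all add: mat_adj_simps mat_adj_mat_Im)
  \<comment> \<open>The square has been completed in \<open>1 + x^2 \<le> 8 d \<beta> x\<close> for
    \<open>x = op_norm W\<close>; the two claimed bounds are the roots of the corresponding
    quadratic equation.\<close>
  moreover have "(op_norm W - 4 * d * \<beta>)\<^sup>2 \<le> (4 * d * \<beta>)\<^sup>2 - 1"
  proof -
    let ?a = "\<lambda>n. \<Sum>i\<in>UNIV. (norm (U (Suc n) *v axis i 1))\<^sup>2"
    \<comment> \<open>The Weyl identity is summed over the standard basis; the right-hand side is
      the trace of \<open>mat_Im W\<close>.\<close>
    have "\<epsilon> * (\<Sum>n. ?a n) = (\<Sum>i\<in>UNIV. Im (cdot (W *v axis i 1) (axis i 1)))"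
      by (simp add: suminf_sum weyl(1) sum_distrib_left weyl(2))
    also have "\<dots> \<le> (\<Sum>i\<in>(UNIV :: 'd set). op_norm W)"
    proof (rule sum_mono)
      fix i :: 'd
      have "Im (cdot (W *v axis i 1) (axis i 1)) \<le> norm (W *v axis i 1) * norm (axis i (1 :: complex))"
        using abs_Im_le_cmod cdot_Cauchy_Schwarz by (meson abs_ge_self order_trans)
      then show "Im (cdot (W *v axis i 1) (axis i 1)) \<le> op_norm W"
        using norm_column_le_op_norm[of W i] by (simp add: norm_axis_1)
    qed
    finally have trace: "\<epsilon> * (\<Sum>n. ?a n) \<le> d * op_norm W" by (simp add: d_def)
    have "1 + (op_norm W)\<^sup>2 \<le> 8 * \<epsilon> * \<beta> * (trunc_norm U t)\<^sup>2" using key[of "mat 1"] by simp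
    also have "\<dots> \<le> 8 * \<epsilon> * \<beta> * (\<Sum>n. ?a n)"
      using \<epsilon> \<beta> t by (intro mult_left_mono trunc_norm_le_suminf summable_sum weyl(1) op_norm_sq_le_columns) simp_all
    also have "\<dots> \<le> 8 * \<beta> * (d * op_norm W)"
      using mult_left_mono[OF trace, of "8 * \<beta>"] \<beta> by (simp add: mult_ac)
    finally show ?thesis by (simp add: power2_diff mult_ac)
  qed
  then have "\<bar>op_norm W - 4 * d * \<beta>\<bar> \<le> sqrt ((4 * d * \<beta>)\<^sup>2 - 1)"
    by (intro real_le_rsqrt) simp
  ultimately show ?thesis
    unfolding Let_def \<beta>_def[unfolded t_def, symmetric] d_def[symmetric] W_def[symmetric] by (simp add: abs_le_iff)
qed

end
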